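(* Let $\Gamma$ be a finite group, and let $\mathcal{F}$ be any family of proper subgroups of $\Gamma$. Then $\mathrm{cd}_{\mathcal{F}}(\Gamma)\ge 2$.
   Context: A family $\mathcal{F}$ of subgroups of a group $\Gamma$ is a non-empty set of subgroups closed under conjugation and under taking subgroups. The orbit category $\mathcal{O}_{\mathcal{F}}\Gamma$ has objects the $\Gamma$-sets $\Gamma/H$ with $H\in\mathcal{F}$ and morphisms the $\Gamma$-equivariant maps. An $\mathcal{O}_{\mathcal{F}}\Gamma$-module is a contravariant functor from $\mathcal{O}_{\mathcal{F}}\Gamma$ to abelian groups; these form an abelian category with enough projectives. $\underline{\mathbb{Z}}$ is the constant module with value $\mathbb{Z}$ on objects and the identity on morphisms. The cohomological dimension $\mathrm{cd}_{\mathcal{F}}(\Gamma)\in\{0,1,2,\dots,\infty\}$ is the projective dimension of $\underline{\mathbb{Z}}$ in this category; equivalently, the least $d$ such that $\mathrm{Ext}^{d+1}_{\mathcal{O}_{\mathcal{F}}\Gamma}(\underline{\mathbb{Z}},M)=0$ for all $\mathcal{O}_{\mathcal{F}}\Gamma$-modules $M$. *)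

theory Defs
  imports
    "HOL-Algebra.Elementary_Groups"
    "HOL-Algebra.Left_Coset"
    "HOL-Library.Extended_Nat"
    "HOL-Library.Infinite_Typeclass"
begin

definition subgroup_family :: "('g, 'm) monoid_scheme \<Rightarrow> 'g set set \<Rightarrow> bool" where
  "subgroup_family G F \<longleftrightarrow>
     F \<noteq> {} \<and>
     (\<forall>H\<in>F. subgroup H G) \<and>
     (\<forall>H\<in>F. \<forall>g\<in>carrier G. (g <#\<^bsub>G\<^esub> H) #>\<^bsub>G\<^esub> inv\<^bsub>G\<^esub> g \<in> F) \<and>
     (\<forall>H\<in>F. \<forall>K. subgroup K G \<and> K \<subseteq> H \<longrightarrow> K \<in> F)"

text \<open>
  The object \<open>G/H\<close> is the set of left cosets of \<open>H\<close>, on which \<open>g\<close> acts by \<open>C \<mapsto> g <# C\<close>.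
  Equivariant maps are taken extensional, so that distinct elements of \<open>orbit_mor\<close> are
  distinct maps.
\<close>

definition orbit_obj :: "('g, 'm) monoid_scheme \<Rightarrow> 'g set set \<Rightarrow> 'g set set set" where
  "orbit_obj G F = {lcosets\<^bsub>G\<^esub> H | H. H \<in> F}"

definition orbit_mor ::
  "('g, 'm) monoid_scheme \<Rightarrow> 'g set set \<Rightarrow> 'g set set \<Rightarrow> ('g set \<Rightarrow> 'g set) set" where
  "orbit_mor G S T =
     {f \<in> S \<rightarrow>\<^sub>E T. \<forall>g\<in>carrier G. \<forall>C\<in>S. f (g <#\<^bsub>G\<^esub> C) = g <#\<^bsub>G\<^esub> f C}"

text \<open>
  Data of a contravariant functor from the orbit category to abelian groups (written
  multiplicatively, as \<open>comm_group\<close>): \<open>mmap M S T f\<close> is the homomorphism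
  \<open>mobj M T \<rightarrow> mobj M S\<close> induced by \<open>f : S \<rightarrow> T\<close>.
\<close>

record ('g, 'a) orbit_module =
  mobj :: "'g set set \<Rightarrow> 'a monoid"
  mmap :: "'g set set \<Rightarrow> 'g set set \<Rightarrow> ('g set \<Rightarrow> 'g set) \<Rightarrow> 'a \<Rightarrow> 'a"

definition is_orbit_module ::
  "('g, 'm) monoid_scheme \<Rightarrow> 'g set set \<Rightarrow> ('g, 'a) orbit_module \<Rightarrow> bool" where
  "is_orbit_module G F M \<longleftrightarrow>
     (\<forall>S\<in>orbit_obj G F. comm_group (mobj M S)) \<and>
     (\<forall>S\<in>orbit_obj G F. \<forall>T\<in>orbit_obj G F. \<forall>f\<in>orbit_mor G S T.
        mmap M S T f \<in> hom (mobj M T) (mobj M S)) \<and>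
     (\<forall>S\<in>orbit_obj G F. \<forall>x\<in>carrier (mobj M S). mmap M S S (restrict id S) x = x) \<and>
     (\<forall>S\<in>orbit_obj G F. \<forall>T\<in>orbit_obj G F. \<forall>U\<in>orbit_obj G F.
        \<forall>f\<in>orbit_mor G S T. \<forall>g\<in>orbit_mor G T U. \<forall>x\<in>carrier (mobj M U).
          mmap M S U (compose S g f) x = mmap M S T f (mmap M T U g x))"

definition orbit_module_hom ::
  "('g, 'm) monoid_scheme \<Rightarrow> 'g set set \<Rightarrow> ('g, 'a) orbit_module \<Rightarrow> ('g, 'b) orbit_module
     \<Rightarrow> ('g set set \<Rightarrow> 'a \<Rightarrow> 'b) set" where
  "orbit_module_hom G F M N =
     {\<eta>. (\<forall>S\<in>orbit_obj G F. \<eta> S \<in> hom (mobj M S) (mobj N S)) \<and>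
         (\<forall>S\<in>orbit_obj G F. \<forall>T\<in>orbit_obj G F. \<forall>f\<in>orbit_mor G S T. \<forall>x\<in>carrier (mobj M T).
            \<eta> S (mmap M S T f x) = mmap N S T f (\<eta> T x))}"

text \<open>
  Kernels, images and epimorphisms in this functor category are computed objectwise.
\<close>

definition orbit_module_surj ::
  "('g, 'm) monoid_scheme \<Rightarrow> 'g set set \<Rightarrow> ('g, 'a) orbit_module \<Rightarrow> ('g, 'b) orbit_module
     \<Rightarrow> ('g set set \<Rightarrow> 'a \<Rightarrow> 'b) \<Rightarrow> bool" where
  "orbit_module_surj G F M N \<eta> \<longleftrightarrow>
     (\<forall>S\<in>orbit_obj G F. \<eta> S ` carrier (mobj M S) = carrier (mobj N S))"

definition orbit_module_exact ::
  "('g, 'm) monoid_scheme \<Rightarrow> 'g set set \<Rightarrow> ('g, 'a) orbit_module \<Rightarrow> ('g, 'b) orbit_module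
     \<Rightarrow> ('g, 'c) orbit_module \<Rightarrow> ('g set set \<Rightarrow> 'a \<Rightarrow> 'b) \<Rightarrow> ('g set set \<Rightarrow> 'b \<Rightarrow> 'c) \<Rightarrow> bool" where
  "orbit_module_exact G F L M N \<eta> \<theta> \<longleftrightarrow>
     (\<forall>S\<in>orbit_obj G F. \<eta> S ` carrier (mobj L S) = kernel (mobj M S) (mobj N S) (\<theta> S))"

text \<open>
  HOL cannot quantify over types inside a definition, so the category of modules is that of the
  modules with elements in a type \<open>'u\<close>, which serves as a universe.  If \<open>'u\<close> is infinite and at
  least as large as the carrier of \<open>G\<close> and the family \<open>F\<close>, a module over \<open>'u\<close> is a quotient of a free module that
  again fits into \<open>'u\<close>; hence it is projective in the sense below iff it is projective among
  modules of arbitrary size.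
\<close>

definition projective_orbit_module ::
  "('g, 'm) monoid_scheme \<Rightarrow> 'g set set \<Rightarrow> ('g, 'u) orbit_module \<Rightarrow> bool" where
  "projective_orbit_module G F P \<longleftrightarrow>
     is_orbit_module G F P \<and>
     (\<forall>(M :: ('g, 'u) orbit_module) (N :: ('g, 'u) orbit_module) \<epsilon> \<phi>.
        is_orbit_module G F M \<and> is_orbit_module G F N \<and>
        \<epsilon> \<in> orbit_module_hom G F M N \<and> orbit_module_surj G F M N \<epsilon> \<and>
        \<phi> \<in> orbit_module_hom G F P N \<longrightarrow>
        (\<exists>\<psi>\<in>orbit_module_hom G F P M.
           \<forall>S\<in>orbit_obj G F. \<forall>x\<in>carrier (mobj P S). \<epsilon> S (\<psi> S x) = \<phi> S x))"

text \<open>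
  \<open>\<cdots> \<rightarrow> P 1 \<rightarrow> P 0 \<rightarrow> M \<rightarrow> 0\<close> is exact with all \<open>P i\<close> projective; \<open>d i\<close> is the differential
  \<open>P (i + 1) \<rightarrow> P i\<close> and \<open>\<epsilon>\<close> the augmentation.
\<close>

definition projective_resolution ::
  "('g, 'm) monoid_scheme \<Rightarrow> 'g set set \<Rightarrow> ('g, 'a) orbit_module \<Rightarrow> (nat \<Rightarrow> ('g, 'u) orbit_module)
     \<Rightarrow> (nat \<Rightarrow> 'g set set \<Rightarrow> 'u \<Rightarrow> 'u) \<Rightarrow> ('g set set \<Rightarrow> 'u \<Rightarrow> 'a) \<Rightarrow> bool" where
  "projective_resolution G F M P d \<epsilon> \<longleftrightarrow>
     (\<forall>i. projective_orbit_module G F (P i)) \<and>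
     (\<forall>i. d i \<in> orbit_module_hom G F (P (Suc i)) (P i)) \<and>
     \<epsilon> \<in> orbit_module_hom G F (P 0) M \<and>
     orbit_module_surj G F (P 0) M \<epsilon> \<and>
     orbit_module_exact G F (P 1) (P 0) M (d 0) \<epsilon> \<and>
     (\<forall>i. orbit_module_exact G F (P (Suc (Suc i))) (P (Suc i)) (P i) (d (Suc i)) (d i))"

definition zero_orbit_module ::
  "('g, 'm) monoid_scheme \<Rightarrow> 'g set set \<Rightarrow> ('g, 'a) orbit_module \<Rightarrow> bool" where
  "zero_orbit_module G F M \<longleftrightarrow> (\<forall>S\<in>orbit_obj G F. carrier (mobj M S) = {\<one>\<^bsub>mobj M S\<^esub>})"

text \<open>
  The infimum of the empty set is \<open>\<infinity>\<close>.
\<close>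

definition proj_dim ::
  "'u itself \<Rightarrow> ('g, 'm) monoid_scheme \<Rightarrow> 'g set set \<Rightarrow> ('g, 'a) orbit_module \<Rightarrow> enat" where
  "proj_dim V G F M =
     Inf {enat n | n. \<exists>(P :: nat \<Rightarrow> ('g, 'u) orbit_module) d \<epsilon>.
            projective_resolution G F M P d \<epsilon> \<and> (\<forall>i>n. zero_orbit_module G F (P i))}"

definition const_int_module :: "('g, int) orbit_module" where
  "const_int_module = \<lparr>mobj = (\<lambda>S. integer_group), mmap = (\<lambda>S T f x. x)\<rparr>"

text \<open>
  For finite \<open>G\<close> every infinite universe \<open>'u\<close> gives the usual value: if the projective
  dimension is \<open>n\<close>, there is a resolution of length \<open>n\<close> by countable modules.
\<close>

definition cohom_dim ::
  "'u::infinite itself \<Rightarrow> ('g, 'm) monoid_scheme \<Rightarrow> 'g set set \<Rightarrow> enat" where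
  "cohom_dim V G F = proj_dim V G F const_int_module"

end

theory Submission
  imports Defs "HOL-Algebra.Group_Action" "HOL-Algebra.Multiplicative_Group"
    "HOL-Computational_Algebra.Primes" "HOL-Library.Countable_Set"
begin

text \<open>
  A one-dimensional classifying space for the family \<open>F\<close> would be a tree on which the
  finite group \<open>G\<close> acts with stabilizers in \<open>F\<close>.  A finite group acting on a tree fixes a vertex,
  hence \<open>G\<close> itself would be in \<open>F\<close>.  A resolution
  \<open>0 \<rightarrow> P\<^sub>1 \<rightarrow> P\<^sub>0 \<rightarrow> \<int> \<rightarrow> 0\<close> by projective modules need not come from a tree, but it
  retains enough of one for a counting argument.

  Take a finite \<open>G\<close>-set \<open>X\<close> with stabilizers in \<open>F\<close> such that every \<open>H \<in> F\<close> fixes a point of \<open>X\<close>.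
  The modules \<open>G/H \<mapsto> \<int>[X\<^sup>H]\<close> and \<open>G/H \<mapsto> \<int>[(X \<times> X)\<^sup>H]\<close> are the beginning of another
  resolution of \<open>\<int>\<close>, and comparing it with the given one yields a bicombing (\<open>ex_bicombing\<close>):
  for \<open>x, y \<in> X\<close> an integral chain \<open>c x y\<close> on the directed edges \<open>X \<times> X\<close> with boundary
  \<open>y - x\<close>.  It is additive along concatenation, equivariant, and supported on edges fixed by everything
  that fixes \<open>x\<close> and \<open>y\<close>.  In a tree \<open>c x y\<close> would be the geodesic from \<open>x\<close> to \<open>y\<close>.

  The theorem \<open>fixed_point\<close> says that, when \<open>X\<close> has no superfluous orbits, a bicombing forces a
  point of \<open>X\<close> fixed by all of \<open>G\<close>.  Sending the edge \<open>(u, v)\<close> to \<open>c u v\<close> is an idempotent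
  endomorphism \<open>e\<close> of \<open>\<int>[X \<times> X]\<close> whose image is isomorphic to the kernel of
  \<open>\<int>[X] \<rightarrow> \<int>\<close>.  Its trace, also when twisted by an element \<open>g\<close> and restricted to a fixed set \<open>Z\<close>,
  is therefore \<open>\<bar>Z\<^sup>g\<bar> - 1\<close>  (\<open>trace_on_fixed_set\<close>).  Three consequences give the result.

  \<^item> If \<open>g\<close> acts on \<open>Z\<close> with prime order \<open>p\<close> and without fixed points, then \<open>\<bar>Z\<bar>\<close> and
  the trace \<open>\<bar>Z\<bar> - 1\<close> are both divisible by \<open>p\<close>.  So every \<open>g\<close> preserving a
  nonempty fixed set has a fixed point in it (\<open>invariant_fixed_set_contains_fixed_point\<close>).

  \<^item> On the edges with a given stabilizer \<open>L\<close>, the trace twisted by an element outside \<open>L\<close>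
  vanishes (\<open>twisted_trace_vanishes\<close>).  Hence the trace on the edges with stabilizer conjugate to \<open>L\<close> is
  \<open>\<bar>G\<bar> / \<bar>L\<bar>\<close> times the trace on coinvariants, and the latter counts
  edges of the quotient, which behaves like a forest (\<open>weighted_trace_le\<close>).

  \<^item> As in a finite tree without leaves, this gives too many edges: every edge stabilizer
  that matters has index at least two in a vertex stabilizer, and the count yields
  \<open>\<bar>X\<bar> - 1 \<ge> 2 \<bar>X - O\<bar>\<close> for an orbit \<open>O\<close> with largest stabilizers.  Every other orbit has at least
  \<open>\<bar>O\<bar>\<close> points, so \<open>O\<close> is the only one.  Every element of \<open>G\<close> fixes a point of \<open>O\<close>, and by
  Burnside's lemma this is impossible for a transitive action on more than one point.
\<close>

section \<open>Bicombings on finite sets with a group action\<close>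

text \<open>
  Since \<open>p\<close> is prime, a permutation with \<open>f\<^sup>p = 1\<close> and without fixed points has only orbits of size
  \<open>p\<close>, and \<open>h\<close> is constant on each.  The induction removes one orbit at a time.
\<close>

lemma prime_dvd_sum_of_free_permutation:
  fixes h :: "'a \<Rightarrow> int"
  assumes "prime p" and "finite Z"
    and "f ` Z \<subseteq> Z" and "\<And>z. z \<in> Z \<Longrightarrow> (f ^^ p) z = z" and "\<And>z. z \<in> Z \<Longrightarrow> f z \<noteq> z"
    and "\<And>z. z \<in> Z \<Longrightarrow> h (f z) = h z"
  shows "int p dvd (\<Sum>z\<in>Z. h z)"
  using assms(2-)
proof (induction "card Z" arbitrary: Z rule: less_induct)
  case less
  show ?case
  proof (cases "Z = {}")
    case False
    then obtain z where z: "z \<in> Z" by blast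
    have in_Z: "(f ^^ i) z \<in> Z" for i
      using z less.prems(2) by (induction i) auto
    define Orb where "Orb = (\<lambda>i. (f ^^ i) z) ` {..<p}"
    have p: "p > 0" using assms(1) prime_gt_0_nat by blast
    have period: "(f ^^ (p * k)) w = w" if "w \<in> Z" for k w
    proof (induction k)
      case (Suc k)
      have "(f ^^ (p * Suc k)) w = (f ^^ p) ((f ^^ (p * k)) w)"
        by (simp only: mult_Suc_right funpow_add o_apply)
      then show ?case using Suc less.prems(3)[OF that] by simp
    qed simp
    have inj: "inj_on (\<lambda>i. (f ^^ i) z) {..<p}"
    proof (rule linorder_inj_onI)
      fix i j assume ij: "i < j" "i \<in> {..<p}" "j \<in> {..<p}"
      show "(f ^^ i) z \<noteq> (f ^^ j) z"
      proof
        assume eq: "(f ^^ i) z = (f ^^ j) z"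
        define d where "d = j - i"
        define w where "w = (f ^^ i) z"
        have d: "0 < d" "d < p" using ij by (auto simp: d_def)
        have w: "w \<in> Z" by (simp add: w_def in_Z)
        have "(f ^^ d) w = (f ^^ j) z"
          using ij by (simp add: d_def w_def funpow_add[symmetric, unfolded o_def, THEN fun_cong])
        then have dw: "(f ^^ d) w = w" using eq by (simp add: w_def)
        have dk: "(f ^^ (d * k)) w = w" for k
        proof (induction k)
          case (Suc k)
          have "(f ^^ (d * Suc k)) w = (f ^^ d) ((f ^^ (d * k)) w)"
            by (simp only: mult_Suc_right funpow_add o_apply)
          then show ?case using Suc dw by simp
        qed simp
        \<comment> \<open>both \<open>d\<close> and \<open>p\<close> are periods of \<open>w\<close>, hence so is their gcd\<close>
        have "coprime d p"
          using assms(1) d by (metis coprime_commute nat_dvd_not_less prime_imp_coprime_nat)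
        then obtain k l where "d * k = p * l + 1"
          using bezout_nat[of d p] d by (metis coprime_imp_gcd_eq_1 gr_implies_not0)
        then have "w = (f ^^ (1 + p * l)) w" using dk[of k] by simp
        also have "\<dots> = f ((f ^^ (p * l)) w)" by simp
        also have "\<dots> = f w" using period[OF w] by simp
        finally show False using less.prems(4)[OF w] by simp
      qed
    qed auto
    have Orb: "Orb \<subseteq> Z" "finite Orb" "card Orb = p"
      using in_Z inj by (auto simp: Orb_def card_image)
    have h_const: "h ((f ^^ i) z) = h z" for i
      using in_Z less.prems(5) by (induction i) auto
    have sum_Orb: "(\<Sum>w\<in>Orb. h w) = int p * h z"
      unfolding Orb_def by (subst sum.reindex[OF inj]) (simp add: h_const)
    have f_inj: "inj_on f Z"
    proof (rule inj_on_inverseI)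
      fix w assume "w \<in> Z"
      have "(f ^^ (p - 1)) (f w) = (f ^^ Suc (p - 1)) w" by (simp only: funpow_Suc_right o_apply)
      then show "(f ^^ (p - 1)) (f w) = w" using p less.prems(3)[OF \<open>w \<in> Z\<close>] by simp
    qed
    have f_Orb: "w \<in> Orb" if "f w \<in> Orb" "w \<in> Z" for w
    proof -
      have "f ` Orb \<subseteq> Orb"
      proof
        fix y assume "y \<in> f ` Orb"
        then obtain i where i: "i < p" "y = (f ^^ Suc i) z" by (auto simp: Orb_def)
        show "y \<in> Orb"
        proof (cases "Suc i = p")
          case True
          then have "y = (f ^^ 0) z" using i less.prems(3)[OF z] by simp
          then show ?thesis using p unfolding Orb_def by blast
        next
          case False
          then show ?thesis using i unfolding Orb_def by (intro image_eqI[where x = "Suc i"]) auto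
        qed
      qed
      then have "f ` Orb = Orb"
        using Orb f_inj by (metis card_image card_subset_eq inj_on_subset)
      then obtain w' where "w' \<in> Orb" "f w' = f w" using \<open>f w \<in> Orb\<close> by (metis imageE)
      then show ?thesis using f_inj Orb \<open>w \<in> Z\<close> by (metis inj_onD subsetD)
    qed
    have "int p dvd (\<Sum>w\<in>Z - Orb. h w)"
    proof (rule less.hyps)
      show "card (Z - Orb) < card Z"
        using Orb p less.prems(1) by (metis Diff_subset card_mono card_Diff_subset diff_less le_0_eq neq0_conv)
      show "f ` (Z - Orb) \<subseteq> Z - Orb" using less.prems(2) f_Orb by blast
    qed (use less.prems in auto)
    moreover have "(\<Sum>w\<in>Z. h w) = (\<Sum>w\<in>Z - Orb. h w) + (\<Sum>w\<in>Orb. h w)"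
      using sum.subset_diff[OF Orb(1) less.prems(1)] by simp
    ultimately show ?thesis using sum_Orb by simp
  qed simp
qed

text \<open>
  An algebraic substitute for the geodesics of a tree: \<open>c x y u v\<close> is the multiplicity of the directed
  edge \<open>(u, v)\<close> in the path from \<open>x\<close> to \<open>y\<close>.  The support condition replaces the fact that a group
  element fixing both ends of a geodesic fixes it pointwise.
\<close>

locale equivariant_bicombing = group_action G E \<phi> for G (structure) and E and \<phi> +
  fixes c :: "'b \<Rightarrow> 'b \<Rightarrow> 'b \<Rightarrow> 'b \<Rightarrow> int"
  assumes finite_G: "finite (carrier G)" and finite_E: "finite E"
    and c_add: "\<lbrakk>x \<in> E; y \<in> E; z \<in> E; u \<in> E; v \<in> E\<rbrakk> \<Longrightarrow> c x z u v = c x y u v + c y z u v"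
    and c_equivariant: "\<lbrakk>g \<in> carrier G; x \<in> E; y \<in> E; u \<in> E; v \<in> E\<rbrakk>
          \<Longrightarrow> c (\<phi> g x) (\<phi> g y) (\<phi> g u) (\<phi> g v) = c x y u v"
    and c_boundary: "\<lbrakk>x \<in> E; y \<in> E; w \<in> E\<rbrakk>
          \<Longrightarrow> (\<Sum>u\<in>E. c x y u w) - (\<Sum>u\<in>E. c x y w u) = of_bool (w = y) - of_bool (w = x)"
    and c_support: "\<lbrakk>x \<in> E; y \<in> E; u \<in> E; v \<in> E; c x y u v \<noteq> 0; g \<in> carrier G; \<phi> g x = x; \<phi> g y = y\<rbrakk>
          \<Longrightarrow> \<phi> g u = u \<and> \<phi> g v = v"
begin

definition fixed :: "'a set \<Rightarrow> 'b set" where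
  "fixed A = {x\<in>E. \<forall>a\<in>A. \<phi> a x = x}"

definition edge_stabilizer :: "'b \<Rightarrow> 'b \<Rightarrow> 'a set" where
  "edge_stabilizer u v = stabilizer G \<phi> u \<inter> stabilizer G \<phi> v"

lemma group_G: "group G"
  using group_hom group_hom.axioms(1) by blast

lemma act_one: "x \<in> E \<Longrightarrow> \<phi> \<one> x = x"
  by (metis id_eq_one restrict_apply')

lemma act_closed: "g \<in> carrier G \<Longrightarrow> x \<in> E \<Longrightarrow> \<phi> g x \<in> E"
  using element_image by blast

lemma fixed_subset: "fixed A \<subseteq> E" by (auto simp: fixed_def)

lemma finite_fixed: "finite (fixed A)"
  using finite_E fixed_subset finite_subset by blast

lemma act_mult: "x \<in> E \<Longrightarrow> g \<in> carrier G \<Longrightarrow> h \<in> carrier G \<Longrightarrow> \<phi> (g \<otimes> h) x = \<phi> g (\<phi> h x)"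
  by (rule composition_rule)

lemma act_inv: "x \<in> E \<Longrightarrow> g \<in> carrier G \<Longrightarrow> \<phi> (inv g) (\<phi> g x) = x"
  using orbit_sym_aux by blast

lemma act_inj: "x \<in> E \<Longrightarrow> y \<in> E \<Longrightarrow> g \<in> carrier G \<Longrightarrow> \<phi> g x = \<phi> g y \<longleftrightarrow> x = y"
  using inj_prop inj_on_eq_iff by metis

lemma act_conjugate:
  assumes "x \<in> E" "a \<in> carrier G" "h \<in> carrier G"
  shows "\<phi> a (\<phi> h x) = \<phi> h x \<longleftrightarrow> \<phi> (inv h \<otimes> (a \<otimes> h)) x = x"
proof -
  interpret group G by (rule group_G)
  have "h \<otimes> (inv h \<otimes> (a \<otimes> h)) = a \<otimes> h" using assms by (simp add: m_assoc[symmetric])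
  then have "\<phi> a (\<phi> h x) = \<phi> h (\<phi> (inv h \<otimes> (a \<otimes> h)) x)"
    using assms by (metis act_mult inv_closed m_closed)
  then show ?thesis using assms act_inj act_closed by simp
qed

lemma translate_fixed:
  assumes "L \<subseteq> carrier G" and g: "g \<in> carrier G"
    and "\<And>a. a \<in> L \<Longrightarrow> inv g \<otimes> (a \<otimes> g) \<in> L"
  shows "\<phi> g ` fixed L \<subseteq> fixed L"
proof
  fix w assume "w \<in> \<phi> g ` fixed L"
  then obtain z where z: "z \<in> E" "\<And>a. a \<in> L \<Longrightarrow> \<phi> a z = z" "w = \<phi> g z" by (auto simp: fixed_def)
  have "\<phi> a w = w" if a: "a \<in> L" for a
    using act_conjugate[OF z(1) subsetD[OF assms(1) a] g] z(2)[OF assms(3)[OF a]] z(3) by simp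
  then show "w \<in> fixed L" using z act_closed g by (auto simp: fixed_def)
qed

lemma bij_betw_invariant:
  assumes "g \<in> carrier G" and "Z \<subseteq> E" and "\<phi> g ` Z \<subseteq> Z"
  shows "bij_betw (\<phi> g) Z Z"
proof -
  have "inj_on (\<phi> g) Z" using inj_prop assms inj_on_subset by blast
  moreover have "\<phi> g ` Z = Z"
    using assms calculation finite_E
    by (metis card_image card_subset_eq finite_subset)
  ultimately show ?thesis by (simp add: bij_betw_def)
qed

text \<open>
  The map \<open>y - x \<mapsto> c x y\<close> is a section of the boundary map from edge chains to the kernel of the
  augmentation, so \<open>(u, v) \<mapsto> c u v\<close> is an idempotent on edge chains with image isomorphic to that
  kernel.  The support condition lets it restrict to a fixed set.  The left-hand side is the trace of
  this idempotent followed by \<open>g\<^sup>-\<^sup>1\<close>; the right-hand side is the character of the kernel.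
\<close>

lemma trace_on_fixed_set:
  assumes "A \<subseteq> carrier G" and "fixed A \<noteq> {}" and g: "g \<in> carrier G" "\<phi> g ` fixed A \<subseteq> fixed A"
  shows "(\<Sum>u\<in>fixed A. \<Sum>v\<in>fixed A. c u v (\<phi> g u) (\<phi> g v))
           = int (card {z\<in>fixed A. \<phi> g z = z}) - 1"
proof -
  define Z where "Z = fixed A"
  have ZE: "Z \<subseteq> E" and finZ: "finite Z" by (auto simp: Z_def fixed_def finite_E)
  obtain x where x: "x \<in> Z" using assms(2) Z_def by blast
  have bij: "bij_betw (\<phi> g) Z Z" using bij_betw_invariant g ZE Z_def by blast
  have gZ: "\<phi> g z \<in> Z" if "z \<in> Z" for z using that g Z_def by blast
  have outside: "c x y u v = 0" if "y \<in> Z" "u \<in> E" "v \<in> E" "\<not> (u \<in> Z \<and> v \<in> Z)" for y u v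
    using c_support[of x y u v] that x ZE assms(1) unfolding Z_def fixed_def by blast
  \<comment> \<open>with a base point \<open>x\<close>, \<open>c u v\<close> is \<open>c x v - c x u\<close>, and the double sum becomes a sum of boundaries\<close>
  have "(\<Sum>u\<in>Z. \<Sum>v\<in>Z. c u v (\<phi> g u) (\<phi> g v))
      = (\<Sum>u\<in>Z. \<Sum>v\<in>Z. c x v (\<phi> g u) (\<phi> g v) - c x u (\<phi> g u) (\<phi> g v))"
  proof (intro sum.cong refl)
    fix u v assume uv: "u \<in> Z" "v \<in> Z"
    have "c x v (\<phi> g u) (\<phi> g v) = c x u (\<phi> g u) (\<phi> g v) + c u v (\<phi> g u) (\<phi> g v)"
      by (rule c_add) (use uv x gZ ZE in blast)+
    then show "c u v (\<phi> g u) (\<phi> g v) = c x v (\<phi> g u) (\<phi> g v) - c x u (\<phi> g u) (\<phi> g v)" by simp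
  qed
  also have "\<dots> = (\<Sum>v\<in>Z. \<Sum>u\<in>Z. c x v (\<phi> g u) (\<phi> g v)) - (\<Sum>u\<in>Z. \<Sum>v\<in>Z. c x u (\<phi> g u) (\<phi> g v))"
    by (simp add: sum_subtractf) (rule sum.swap)
  also have "\<dots> = (\<Sum>w\<in>Z. (\<Sum>u\<in>Z. c x w (\<phi> g u) (\<phi> g w)) - (\<Sum>u\<in>Z. c x w (\<phi> g w) (\<phi> g u)))"
    by (simp add: sum_subtractf)
  also have "\<dots> = (\<Sum>w\<in>Z. (\<Sum>u\<in>Z. c x w u (\<phi> g w)) - (\<Sum>u\<in>Z. c x w (\<phi> g w) u))"
    by (rule sum.cong[OF refl], rule arg_cong2[where f="(-)"])
       (rule sum.reindex_bij_betw[OF bij])+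
  also have "\<dots> = (\<Sum>w\<in>Z. (\<Sum>u\<in>E. c x w u (\<phi> g w)) - (\<Sum>u\<in>E. c x w (\<phi> g w) u))"
  proof (rule sum.cong[OF refl], rule arg_cong2[where f="(-)"])
    fix w assume w: "w \<in> Z"
    show "(\<Sum>u\<in>Z. c x w u (\<phi> g w)) = (\<Sum>u\<in>E. c x w u (\<phi> g w))"
      by (intro sum.mono_neutral_left finite_E ZE ballI outside) (use w gZ ZE in auto)
    show "(\<Sum>u\<in>Z. c x w (\<phi> g w) u) = (\<Sum>u\<in>E. c x w (\<phi> g w) u)"
      by (intro sum.mono_neutral_left finite_E ZE ballI outside) (use w gZ ZE in auto)
  qed
  also have "\<dots> = (\<Sum>w\<in>Z. of_bool (\<phi> g w = w) - of_bool (\<phi> g w = x))"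
    by (intro sum.cong refl c_boundary) (use x gZ ZE in blast)+
  also have "\<dots> = int (card {z\<in>Z. \<phi> g z = z}) - (\<Sum>w\<in>Z. of_bool (\<phi> g w = x))"
    using finZ by (simp add: sum_subtractf sum.If_cases Int_def flip: of_bool_conj)
  also have "(\<Sum>w\<in>Z. of_bool (\<phi> g w = x)) = (\<Sum>w\<in>Z. of_bool (w = x) :: int)"
    using sum.reindex_bij_betw[OF bij, of "\<lambda>w. of_bool (w = x)"] by simp
  also have "\<dots> = 1" using x finZ by (simp add: of_bool_def)
  finally show ?thesis by (simp add: Z_def)
qed


lemma fixed_insert: "fixed (insert g A) = {z \<in> fixed A. \<phi> g z = z}"
  by (auto simp: fixed_def)

lemma act_pow: "\<phi> (g [^] (n::nat)) x = (\<phi> g ^^ n) x" if "g \<in> carrier G" "x \<in> E"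
proof (induction n)
  case 0
  show ?case using that act_one by simp
next
  case (Suc n)
  interpret group G by (rule group_G)
  have "g [^] Suc n = g \<otimes> g [^] n" using that nat_pow_Suc2 by simp
  then have "\<phi> (g [^] Suc n) x = \<phi> g (\<phi> (g [^] n) x)"
    using composition_rule[of x g "g [^] n"] that by simp
  then show ?case using Suc by simp
qed

text \<open>
  Only here is it essential that the chains \<open>c x y\<close> are integral and not just rational.  If \<open>g\<close> moved
  every point of \<open>Z = fixed A\<close>, it would act freely on \<open>Z\<close> and \<open>Z \<times> Z\<close> with orbits of size \<open>p\<close>.
  Then \<open>p\<close> divides both \<open>\<bar>Z\<bar>\<close> and the trace \<open>\<bar>Z\<bar> - 1\<close>, because the diagonal entries
  \<open>c u v u v\<close> are constant on orbits.
\<close>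

lemma fixed_point_of_prime_order_element:
  assumes "A \<subseteq> carrier G" and "fixed A \<noteq> {}" and g: "g \<in> carrier G" "\<phi> g ` fixed A \<subseteq> fixed A"
    and "prime p" and pow: "\<And>z. z \<in> fixed A \<Longrightarrow> (\<phi> g ^^ p) z = z"
  shows "fixed (insert g A) \<noteq> {}"
proof
  assume "fixed (insert g A) = {}"
  then have free: "\<phi> g z \<noteq> z" if "z \<in> fixed A" for z using that by (auto simp: fixed_insert)
  let ?Z = "fixed A"
  have ZE: "?Z \<subseteq> E" by (rule fixed_subset)
  have one: "\<one> \<in> carrier G" "\<And>z. z \<in> E \<Longrightarrow> \<phi> \<one> z = z"
    using act_one by (auto simp: group.is_monoid group_G monoid.one_closed)
  have "int p dvd (\<Sum>z\<in>?Z. 1)"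
    using prime_dvd_sum_of_free_permutation[OF \<open>prime p\<close> finite_fixed g(2) pow free, of "\<lambda>_. 1"] by simp
  then have p_card: "int p dvd int (card ?Z)" by simp
  have pair_pow: "(map_prod (\<phi> g) (\<phi> g) ^^ n) (u, v) = ((\<phi> g ^^ n) u, (\<phi> g ^^ n) v)" for n u v
    by (induction n) auto
  have "int p dvd (\<Sum>(u, v)\<in>?Z \<times> ?Z. c u v u v)"
    by (rule prime_dvd_sum_of_free_permutation[OF \<open>prime p\<close>, where f = "map_prod (\<phi> g) (\<phi> g)"])
       (use finite_fixed g free pow ZE c_equivariant in \<open>auto simp: pair_pow subset_iff\<close>)
  also have "(\<Sum>(u, v)\<in>?Z \<times> ?Z. c u v u v) = (\<Sum>u\<in>?Z. \<Sum>v\<in>?Z. c u v (\<phi> \<one> u) (\<phi> \<one> v))"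
    unfolding sum.cartesian_product using one(2)[OF subsetD[OF ZE]] by (intro sum.cong) auto
  also have "\<dots> = int (card {z\<in>?Z. \<phi> \<one> z = z}) - 1"
    by (rule trace_on_fixed_set) (use assms one ZE in auto)
  also have "{z\<in>?Z. \<phi> \<one> z = z} = ?Z" using one(2) ZE by auto
  finally have "int p dvd 1" using p_card by (metis dvd_diff_right_iff)
  then show False using \<open>prime p\<close> by simp
qed

text \<open>
  If \<open>g\<^sup>n\<close> has a fixed point in the set and \<open>p\<close> is a prime factor of \<open>n\<close>, then \<open>g\<^sup>n\<^sup>/\<^sup>p\<close> acts on the
  fixed points of \<open>g\<^sup>n\<close> with order \<open>p\<close> and has a fixed point among them.  The descent starts at
  \<open>n = \<bar>G\<bar>\<close>.
\<close>

lemma invariant_fixed_set_contains_fixed_point: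
  assumes "A \<subseteq> carrier G" and "fixed A \<noteq> {}" and g: "g \<in> carrier G" "\<phi> g ` fixed A \<subseteq> fixed A"
  shows "fixed (insert g A) \<noteq> {}"
proof -
  interpret group G by (rule group_G)
  have "fixed (insert (g [^] n) A) \<noteq> {} \<Longrightarrow> fixed (insert g A) \<noteq> {}" if "n > 0" for n :: nat
    using that
  proof (induction n rule: less_induct)
    case (less n)
    show ?case
    proof (cases "n = 1")
      case True
      then show ?thesis using less.prems g by simp
    next
      case False
      then obtain p where p: "prime p" "p dvd n" using prime_factor_nat by blast
      then obtain m where m: "n = m * p" by (metis dvd_def mult.commute)
      let ?B = "insert (g [^] n) A" and ?h = "g [^] m"
      have h: "?h \<in> carrier G" using g by simp
      have pow_A: "(\<phi> g ^^ k) z \<in> fixed A" if "z \<in> fixed A" for k z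
        using that g by (induction k) auto
      have fixedB: "z \<in> fixed ?B \<longleftrightarrow> z \<in> fixed A \<and> (\<phi> g ^^ n) z = z" for z
        using act_pow[OF g(1) subsetD[OF fixed_subset]] by (auto simp: fixed_insert)
      have "fixed (insert ?h ?B) \<noteq> {}"
      proof (rule fixed_point_of_prime_order_element[OF _ _ h _ p(1)])
        show "?B \<subseteq> carrier G" using assms g by simp
        show "fixed ?B \<noteq> {}" by (rule less.prems)
        have act_h: "\<phi> ?h z = (\<phi> g ^^ m) z" if "z \<in> fixed A" for z
          using act_pow[OF g(1)] that fixed_subset by blast
        show "\<phi> ?h ` fixed ?B \<subseteq> fixed ?B"
        proof
          fix w assume "w \<in> \<phi> ?h ` fixed ?B"
          then obtain z where z: "z \<in> fixed A" "(\<phi> g ^^ n) z = z" "w = (\<phi> g ^^ m) z"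
            using fixedB act_h by auto
          have "(\<phi> g ^^ n) w = (\<phi> g ^^ m) ((\<phi> g ^^ n) z)"
            unfolding z(3) by (simp only: funpow_add[symmetric, unfolded o_def, THEN fun_cong] add.commute)
          then show "w \<in> fixed ?B" using z pow_A fixedB by simp
        qed
        have "(\<phi> ?h ^^ k) z = (\<phi> g ^^ (m * k)) z" if "z \<in> fixed A" for k z
        proof (induction k)
          case (Suc k)
          then show ?case
            using act_h pow_A[OF that] by (simp add: funpow_add)
        qed simp
        then show "(\<phi> ?h ^^ p) z = z" if "z \<in> fixed ?B" for z
          using that fixedB m by simp
      qed
      moreover have "fixed (insert ?h ?B) \<subseteq> fixed (insert ?h A)" by (auto simp: fixed_def)
      ultimately have "fixed (insert ?h A) \<noteq> {}" by blast
      moreover have "m > 0" using m \<open>n > 0\<close> by (cases "m = 0") auto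
      moreover from this have "m < n" using n_less_m_mult_n[of m p] prime_gt_1_nat[OF p(1)] m by simp
      ultimately show ?thesis using less.IH by blast
    qed
  qed
  moreover have "fixed (insert (g [^] order G) A) \<noteq> {}"
  proof -
    have "fixed (insert \<one> A) = fixed A" using act_one by (auto simp: fixed_def)
    then show ?thesis using assms(2) pow_order_eq_1[OF g(1)] by simp
  qed
  ultimately show ?thesis using order_gt_0_iff_finite finite_G by blast
qed


lemma subgroup_edge_stabilizer:
  assumes "u \<in> E" "v \<in> E"
  shows "subgroup (edge_stabilizer u v) G"
  unfolding edge_stabilizer_def
  by (intro group.subgroups_Inter_pair group_G stabilizer_subgroup assms)

lemma edge_stabilizer_subset: "edge_stabilizer u v \<subseteq> carrier G"
  by (auto simp: edge_stabilizer_def stabilizer_def)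

lemma mem_edge_stabilizer:
  "g \<in> edge_stabilizer u v \<longleftrightarrow> g \<in> carrier G \<and> \<phi> g u = u \<and> \<phi> g v = v"
  by (auto simp: edge_stabilizer_def stabilizer_def)

lemma sum_by_edge_stabilizer:
  fixes h :: "'b \<times> 'b \<Rightarrow> int"
  assumes "W \<subseteq> E \<times> E" and "\<And>p. p \<in> W \<Longrightarrow> case_prod edge_stabilizer p \<in> T" and "finite T"
  shows "(\<Sum>L\<in>T. \<Sum>p\<in>{p\<in>W. case_prod edge_stabilizer p = L}. h p) = (\<Sum>p\<in>W. h p)"
  using assms finite_E by (intro sum.group) (auto intro: finite_subset)

text \<open>
  For \<open>g\<close> normalizing \<open>L\<close> this says that the character of the \<open>N(L)/L\<close>-module cut out by the
  idempotent on edges with stabilizer \<open>L\<close> vanishes at nontrivial elements, as Swan's theorem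
  predicts for a projective module.  The twisted trace is the same on \<open>fixed L\<close> and on
  \<open>fixed (insert g L)\<close>, as both sets have the same \<open>g\<close>-fixed points.  The difference is the twisted
  trace on all edges moved by \<open>g\<close> whose stabilizer contains \<open>L\<close>; by induction the stabilizers larger
  than \<open>L\<close> contribute nothing.
\<close>

lemma twisted_trace_vanishes:
  assumes g: "g \<in> carrier G"
  shows "(\<Sum>(u, v)\<in>{(u, v)\<in>E \<times> E. edge_stabilizer u v = L \<and> g \<notin> edge_stabilizer u v}.
            c u v (\<phi> g u) (\<phi> g v)) = 0"
proof (induction "card (carrier G) - card L" arbitrary: L rule: less_induct)
  case less
  let ?f = "\<lambda>(u, v). c u v (\<phi> g u) (\<phi> g v)"
  let ?stab = "case_prod edge_stabilizer"
  show ?case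
  \<comment> \<open>if some summand is nonzero, the support condition forces \<open>g\<close> to normalize \<open>L\<close>\<close>
  proof (cases "\<exists>u v. u \<in> E \<and> v \<in> E \<and> edge_stabilizer u v = L \<and> c u v (\<phi> g u) (\<phi> g v) \<noteq> 0")
    case False
    then show ?thesis by (intro sum.neutral) auto
  next
    case True
    then obtain u v where uv: "u \<in> E" "v \<in> E" "edge_stabilizer u v = L" "c u v (\<phi> g u) (\<phi> g v) \<noteq> 0"
      by blast
    interpret group G by (rule group_G)
    have L: "L \<subseteq> carrier G" using uv(3) edge_stabilizer_subset by blast
    have ne: "fixed L \<noteq> {}" using uv by (auto simp: fixed_def mem_edge_stabilizer)
    have inv: "\<phi> g ` fixed L \<subseteq> fixed L"
    proof (rule translate_fixed[OF L g])
      fix a assume a: "a \<in> L"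
      then have aG: "a \<in> carrier G" using L by blast
      have "\<phi> a (\<phi> g u) = \<phi> g u \<and> \<phi> a (\<phi> g v) = \<phi> g v"
        using c_support[of u v "\<phi> g u" "\<phi> g v" a] uv a aG act_closed g by (auto simp: mem_edge_stabilizer)
      then have "inv g \<otimes> (a \<otimes> g) \<in> edge_stabilizer u v"
        using act_conjugate[OF uv(1) aG g] act_conjugate[OF uv(2) aG g] aG g by (simp add: mem_edge_stabilizer)
      then show "inv g \<otimes> (a \<otimes> g) \<in> L" using uv(3) by simp
    qed
    let ?Z = "fixed L" and ?Z' = "fixed (insert g L)"
    have ne': "?Z' \<noteq> {}" by (rule invariant_fixed_set_contains_fixed_point[OF L ne g inv])
    have fixed_twice: "{z \<in> ?Z'. \<phi> g z = z} = ?Z'" "{z \<in> ?Z. \<phi> g z = z} = ?Z'"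
      by (auto simp: fixed_insert)
    have "(\<Sum>p\<in>?Z \<times> ?Z. ?f p) = int (card ?Z') - 1"
      using trace_on_fixed_set[OF L ne g inv] fixed_twice by (simp add: sum.cartesian_product)
    moreover have "(\<Sum>p\<in>?Z' \<times> ?Z'. ?f p) = int (card ?Z') - 1"
    proof -
      have "insert g L \<subseteq> carrier G" and "\<phi> g ` ?Z' \<subseteq> ?Z'" using L g by (auto simp: fixed_insert)
      from trace_on_fixed_set[OF this(1) ne' g this(2)] show ?thesis
        using fixed_twice by (simp add: sum.cartesian_product)
    qed
    moreover have "?Z' \<times> ?Z' \<subseteq> ?Z \<times> ?Z" by (auto simp: fixed_insert)
    ultimately have zero: "(\<Sum>p\<in>?Z \<times> ?Z - ?Z' \<times> ?Z'. ?f p) = 0"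
      by (simp add: sum_diff finite_fixed)
    define W where "W = {(u, v)\<in>E \<times> E. L \<subseteq> edge_stabilizer u v \<and> g \<notin> edge_stabilizer u v}"
    have W: "?Z \<times> ?Z - ?Z' \<times> ?Z' = W"
      using g L by (auto simp: W_def fixed_def mem_edge_stabilizer subset_iff)
    define T where "T = {L'. L \<subseteq> L' \<and> L' \<subseteq> carrier G}"
    have finT: "finite T" using finite_G by (simp add: T_def)
    have LT: "L \<in> T" using L by (simp add: T_def)
    have "(\<Sum>L'\<in>T. \<Sum>p\<in>{p\<in>W. ?stab p = L'}. ?f p) = (\<Sum>p\<in>W. ?f p)"
      by (rule sum_by_edge_stabilizer[OF _ _ finT])
         (use edge_stabilizer_subset in \<open>auto simp: W_def T_def\<close>)
    then have "(\<Sum>L'\<in>T. \<Sum>p\<in>{p\<in>W. ?stab p = L'}. ?f p) = 0" using zero W by simp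
    moreover have "(\<Sum>p\<in>{p\<in>W. ?stab p = L'}. ?f p) = 0" if "L' \<in> T - {L}" for L'
    proof -
      have "L \<subset> L'" "L' \<subseteq> carrier G" using that by (auto simp: T_def)
      then have "card L < card L'" "card L' \<le> card (carrier G)"
        using finite_G by (auto intro!: psubset_card_mono card_mono intro: finite_subset)
      then have "(\<Sum>(u, v)\<in>{(u, v)\<in>E \<times> E. edge_stabilizer u v = L' \<and> g \<notin> edge_stabilizer u v}.
            c u v (\<phi> g u) (\<phi> g v)) = 0"
        by (intro less) simp
      moreover have "{p\<in>W. ?stab p = L'} = {(u, v)\<in>E \<times> E. edge_stabilizer u v = L' \<and> g \<notin> edge_stabilizer u v}"
        using \<open>L \<subset> L'\<close> by (auto simp: W_def)
      ultimately show ?thesis by simp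
    qed
    ultimately have "(\<Sum>p\<in>{p\<in>W. ?stab p = L}. ?f p) = 0"
      using sum.remove[OF finT LT, of "\<lambda>L'. \<Sum>p\<in>{p\<in>W. ?stab p = L'}. ?f p"] by simp
    moreover have "{p\<in>W. ?stab p = L} = {(u, v)\<in>E \<times> E. edge_stabilizer u v = L \<and> g \<notin> edge_stabilizer u v}"
      by (auto simp: W_def)
    ultimately show ?thesis by simp
  qed
qed

end

section \<open>Traces on edges with large stabilizers\<close>

context equivariant_bicombing
begin

text \<open>
  Edges are filtered by the order of their stabilizer.  By the support condition the idempotent
  \<open>(u, v) \<mapsto> c u v\<close> maps chains on \<open>thick j\<close> to chains on \<open>thick j\<close>.
\<close>

definition thick :: "nat \<Rightarrow> ('b \<times> 'b) set" where
  "thick j = {(u, v)\<in>E \<times> E. j \<le> card (edge_stabilizer u v)}"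

text \<open>
  By \<open>weighted_trace_eq_sum_twisted\<close>, this is \<open>\<bar>G\<bar>\<close> times the trace of the idempotent on the coinvariants of
  chains on \<open>thick j\<close>.
\<close>

definition weighted_trace :: "nat \<Rightarrow> int" where
  "weighted_trace j = (\<Sum>(u, v)\<in>thick j. int (card (edge_stabilizer u v)) * c u v u v)"

lemma finite_thick: "finite (thick j)"
  by (rule finite_subset[of _ "E \<times> E"]) (auto simp: thick_def finite_E)

lemma finite_edge_stabilizer: "finite (edge_stabilizer u v)"
  using edge_stabilizer_subset finite_G finite_subset by blast

text \<open>
  An edge with stabilizer \<open>L\<close> contributes its diagonal entry once for every \<open>g \<in> L\<close>; the
  contributions of \<open>g \<notin> L\<close> cancel by \<open>twisted_trace_vanishes\<close>.
\<close>

lemma weighted_trace_eq_sum_twisted: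
  "weighted_trace j = (\<Sum>g\<in>carrier G. \<Sum>(u, v)\<in>thick j. c u v (\<phi> g u) (\<phi> g v))"
proof -
  have moved: "(\<Sum>(u, v)\<in>{(u, v)\<in>thick j. g \<notin> edge_stabilizer u v}. c u v (\<phi> g u) (\<phi> g v)) = 0"
    if g: "g \<in> carrier G" for g
  proof -
    let ?f = "\<lambda>(u, v). c u v (\<phi> g u) (\<phi> g v)"
    let ?W = "{(u, v)\<in>thick j. g \<notin> edge_stabilizer u v}"
    have fibre: "{p\<in>?W. case_prod edge_stabilizer p = L}
        = (if j \<le> card L then {(u, v)\<in>E \<times> E. edge_stabilizer u v = L \<and> g \<notin> edge_stabilizer u v} else {})" for L
      by (auto simp: thick_def)
    have "(\<Sum>p\<in>?W. ?f p) = (\<Sum>L\<in>Pow (carrier G). \<Sum>p\<in>{p\<in>?W. case_prod edge_stabilizer p = L}. ?f p)"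
      by (rule sum_by_edge_stabilizer[symmetric])
         (use edge_stabilizer_subset finite_G in \<open>auto simp: thick_def\<close>)
    also have "\<dots> = 0"
      unfolding fibre using twisted_trace_vanishes[OF g] by (intro sum.neutral) simp
    finally show ?thesis .
  qed
  have "(\<Sum>g\<in>carrier G. \<Sum>(u, v)\<in>thick j. c u v (\<phi> g u) (\<phi> g v))
      = (\<Sum>g\<in>carrier G. \<Sum>(u, v)\<in>thick j. of_bool (g \<in> edge_stabilizer u v) * c u v u v)"
  proof (rule sum.cong[OF refl])
    fix g assume g: "g \<in> carrier G"
    have "(\<Sum>(u, v)\<in>thick j. c u v (\<phi> g u) (\<phi> g v))
        = (\<Sum>(u, v)\<in>{(u, v)\<in>thick j. g \<notin> edge_stabilizer u v}. c u v (\<phi> g u) (\<phi> g v))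
        + (\<Sum>(u, v)\<in>{(u, v)\<in>thick j. g \<in> edge_stabilizer u v}. c u v (\<phi> g u) (\<phi> g v))"
      by (subst sum.union_disjoint[symmetric])
         (auto intro: finite_subset[OF _ finite_thick] intro!: sum.cong)
    also have "\<dots> = (\<Sum>(u, v)\<in>{(u, v)\<in>thick j. g \<in> edge_stabilizer u v}. c u v u v)"
      unfolding moved[OF g] by (auto simp: mem_edge_stabilizer intro!: sum.cong)
    also have "\<dots> = (\<Sum>(u, v)\<in>thick j. of_bool (g \<in> edge_stabilizer u v) * c u v u v)"
      by (rule sum.mono_neutral_cong_left) (auto simp: finite_thick)
    finally show "(\<Sum>(u, v)\<in>thick j. c u v (\<phi> g u) (\<phi> g v))
        = (\<Sum>(u, v)\<in>thick j. of_bool (g \<in> edge_stabilizer u v) * c u v u v)" .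
  qed
  also have "\<dots> = (\<Sum>p\<in>thick j. \<Sum>g\<in>carrier G. case p of (u, v) \<Rightarrow> of_bool (g \<in> edge_stabilizer u v) * c u v u v)"
    by (rule sum.swap)
  also have "\<dots> = weighted_trace j"
    unfolding weighted_trace_def
  proof (rule sum.cong[OF refl])
    fix p assume "p \<in> thick j"
    obtain u v where p: "p = (u, v)" by fastforce
    have "(\<Sum>g\<in>carrier G. of_bool (g \<in> edge_stabilizer u v)) = int (card (edge_stabilizer u v))"
      using finite_G edge_stabilizer_subset[of u v]
      by (simp add: of_bool_def sum.If_cases Int_absorb1)
    then show "(\<Sum>g\<in>carrier G. case p of (u, v) \<Rightarrow> of_bool (g \<in> edge_stabilizer u v) * c u v u v)
        = (case p of (u, v) \<Rightarrow> int (card (edge_stabilizer u v)) * c u v u v)"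
      unfolding p by (simp only: prod.case sum_distrib_right[symmetric])
  qed
  finally show ?thesis by simp
qed

lemma bij_act: "g \<in> carrier G \<Longrightarrow> bij_betw (\<phi> g) E E"
  using bij_betw_invariant act_closed by blast

lemma bij_left_mult:
  assumes "h \<in> carrier G"
  shows "bij_betw (\<lambda>g. h \<otimes> g) (carrier G) (carrier G)"
proof -
  interpret group G by (rule group_G)
  show ?thesis
    by (rule bij_betw_byWitness[where f' = "\<lambda>g. inv h \<otimes> g"])
       (use assms in \<open>auto simp: m_assoc[symmetric]\<close>)
qed

lemma thick_act:
  assumes "g \<in> carrier G" and "u \<in> E" "v \<in> E"
  shows "(\<phi> g u, \<phi> g v) \<in> thick j \<longleftrightarrow> (u, v) \<in> thick j"
proof -
  interpret group G by (rule group_G)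
  have le: "card (edge_stabilizer x y) \<le> card (edge_stabilizer (\<phi> h x) (\<phi> h y))"
    if h: "h \<in> carrier G" and xy: "x \<in> E" "y \<in> E" for h x y
  proof (rule card_inj_on_le[OF _ _ finite_edge_stabilizer])
    show "inj_on (\<lambda>a. h \<otimes> a \<otimes> inv h) (edge_stabilizer x y)"
      using h edge_stabilizer_subset by (intro inj_onI) (auto simp: subset_iff)
    show "(\<lambda>a. h \<otimes> a \<otimes> inv h) ` edge_stabilizer x y \<subseteq> edge_stabilizer (\<phi> h x) (\<phi> h y)"
      using h xy act_closed by (auto simp: mem_edge_stabilizer act_mult act_inv)
  qed
  have "card (edge_stabilizer (\<phi> g u) (\<phi> g v)) \<le> card (edge_stabilizer u v)"
    using le[of "inv g" "\<phi> g u" "\<phi> g v"] assms act_closed by (simp add: act_inv)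
  then show ?thesis using le[OF assms] assms act_closed by (auto simp: thick_def)
qed

text \<open>
  The total multiplicity of the orbit of \<open>w\<close> in the boundary of the part of \<open>c x y\<close> lying on thick
  edges, times the order of the stabilizer of \<open>w\<close>.
\<close>

definition thick_flux :: "nat \<Rightarrow> 'b \<Rightarrow> 'b \<Rightarrow> 'b \<Rightarrow> int" where
  "thick_flux j w x y = (\<Sum>g\<in>carrier G.
      (\<Sum>u\<in>E. of_bool ((u, \<phi> g w) \<in> thick j) * c x y u (\<phi> g w))
    - (\<Sum>u\<in>E. of_bool ((\<phi> g w, u) \<in> thick j) * c x y (\<phi> g w) u))"

lemma thick_flux_add:
  assumes "w \<in> E" "x \<in> E" "y \<in> E" "z \<in> E"
  shows "thick_flux j w x z = thick_flux j w x y + thick_flux j w y z"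
proof -
  have "c x z u (\<phi> g w) = c x y u (\<phi> g w) + c y z u (\<phi> g w)"
       "c x z (\<phi> g w) u = c x y (\<phi> g w) u + c y z (\<phi> g w) u"
    if "u \<in> E" "g \<in> carrier G" for u g
    by (rule c_add; use assms that act_closed in blast)+
  then show ?thesis
    unfolding thick_flux_def by (simp add: sum.distrib sum_subtractf algebra_simps)
qed

lemma thick_flux_act:
  assumes "w \<in> E" "x \<in> E" "y \<in> E" and h: "h \<in> carrier G"
  shows "thick_flux j w (\<phi> h x) (\<phi> h y) = thick_flux j w x y"
proof -
  have "thick_flux j w (\<phi> h x) (\<phi> h y) = (\<Sum>g\<in>carrier G.
      (\<Sum>u\<in>E. of_bool ((u, \<phi> (h \<otimes> g) w) \<in> thick j) * c (\<phi> h x) (\<phi> h y) u (\<phi> (h \<otimes> g) w))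
    - (\<Sum>u\<in>E. of_bool ((\<phi> (h \<otimes> g) w, u) \<in> thick j) * c (\<phi> h x) (\<phi> h y) (\<phi> (h \<otimes> g) w) u))"
    unfolding thick_flux_def by (rule sum.reindex_bij_betw[OF bij_left_mult[OF h], symmetric])
  also have "\<dots> = thick_flux j w x y"
    unfolding thick_flux_def
  proof (rule sum.cong[OF refl], rule arg_cong2[where f="(-)"])
    fix g assume g: "g \<in> carrier G"
    have gw: "\<phi> g w \<in> E" using g assms act_closed by blast
    have hg: "\<phi> (h \<otimes> g) w = \<phi> h (\<phi> g w)" using act_mult g h assms by blast
    show "(\<Sum>u\<in>E. of_bool ((u, \<phi> (h \<otimes> g) w) \<in> thick j) * c (\<phi> h x) (\<phi> h y) u (\<phi> (h \<otimes> g) w))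
        = (\<Sum>u\<in>E. of_bool ((u, \<phi> g w) \<in> thick j) * c x y u (\<phi> g w))"
      unfolding hg
      by (subst sum.reindex_bij_betw[OF bij_act[OF h], symmetric], rule sum.cong)
         (use thick_act[OF h] c_equivariant[OF h] assms gw in auto)
    show "(\<Sum>u\<in>E. of_bool ((\<phi> (h \<otimes> g) w, u) \<in> thick j) * c (\<phi> h x) (\<phi> h y) (\<phi> (h \<otimes> g) w) u)
        = (\<Sum>u\<in>E. of_bool ((\<phi> g w, u) \<in> thick j) * c x y (\<phi> g w) u)"
      unfolding hg
      by (subst sum.reindex_bij_betw[OF bij_act[OF h], symmetric], rule sum.cong)
         (use thick_act[OF h] c_equivariant[OF h] assms gw in auto)
  qed
  finally show ?thesis .
qed

text \<open>
  Summing over \<open>y\<close> exhibits \<open>\<bar>E\<bar> c x (h x)\<close> as \<open>h S - S\<close> with \<open>S = \<Sum>y. c y x\<close>, which vanishes in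
  coinvariants.
\<close>

lemma thick_flux_orbit:
  assumes "w \<in> E" "x \<in> E" and h: "h \<in> carrier G"
  shows "thick_flux j w x (\<phi> h x) = 0"
proof -
  have hx: "\<phi> h x \<in> E" using assms act_closed by blast
  have "int (card E) * thick_flux j w x (\<phi> h x) = (\<Sum>y\<in>E. thick_flux j w x (\<phi> h x))" by simp
  also have "\<dots> = (\<Sum>y\<in>E. thick_flux j w y (\<phi> h x) - thick_flux j w y x)"
  proof (rule sum.cong[OF refl])
    fix y assume "y \<in> E"
    then show "thick_flux j w x (\<phi> h x) = thick_flux j w y (\<phi> h x) - thick_flux j w y x"
      using thick_flux_add[of w y x "\<phi> h x" j] assms hx by simp
  qed
  also have "\<dots> = (\<Sum>y\<in>E. thick_flux j w (\<phi> h y) (\<phi> h x)) - (\<Sum>y\<in>E. thick_flux j w y x)"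
    by (subst sum.reindex_bij_betw[OF bij_act[OF h], of "\<lambda>y. thick_flux j w y (\<phi> h x)"])
       (simp add: sum_subtractf)
  also have "\<dots> = 0"
    using thick_flux_act assms by (simp add: sum_subtractf[symmetric])
  finally have "int (card E) * thick_flux j w x (\<phi> h x) = 0" .
  moreover have "card E \<noteq> 0" using assms(2) finite_E by (metis card_eq_0_iff empty_iff)
  ultimately show ?thesis by simp
qed

text \<open>
  For a thick pair \<open>(x, y)\<close> the whole chain \<open>c x y\<close> lies on thick edges, so its flux is that of its
  boundary \<open>y - x\<close>.
\<close>

lemma thick_flux_thick_edge:
  assumes "w \<in> E" and xy: "(x, y) \<in> thick j"
  shows "thick_flux j w x y = (\<Sum>g\<in>carrier G. of_bool (\<phi> g w = y) - of_bool (\<phi> g w = x))"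
  unfolding thick_flux_def
proof (rule sum.cong[OF refl])
  fix g assume g: "g \<in> carrier G"
  have E: "x \<in> E" "y \<in> E" "\<phi> g w \<in> E" using assms act_closed g by (auto simp: thick_def)
  have in_thick: "(u, v) \<in> thick j \<or> c x y u v = 0" if "u \<in> E" "v \<in> E" for u v
  proof (rule disjCI)
    assume "c x y u v \<noteq> 0"
    then have "edge_stabilizer x y \<subseteq> edge_stabilizer u v"
      using c_support[OF E(1,2) that] by (auto simp: mem_edge_stabilizer)
    then have "card (edge_stabilizer x y) \<le> card (edge_stabilizer u v)"
      by (rule card_mono[OF finite_edge_stabilizer])
    then show "(u, v) \<in> thick j" using that xy by (auto simp: thick_def)
  qed
  have "(\<Sum>u\<in>E. of_bool ((u, \<phi> g w) \<in> thick j) * c x y u (\<phi> g w)) = (\<Sum>u\<in>E. c x y u (\<phi> g w))"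
       "(\<Sum>u\<in>E. of_bool ((\<phi> g w, u) \<in> thick j) * c x y (\<phi> g w) u) = (\<Sum>u\<in>E. c x y (\<phi> g w) u)"
    by (rule sum.cong[OF refl], use in_thick E in force)+
  then show "(\<Sum>u\<in>E. of_bool ((u, \<phi> g w) \<in> thick j) * c x y u (\<phi> g w))
      - (\<Sum>u\<in>E. of_bool ((\<phi> g w, u) \<in> thick j) * c x y (\<phi> g w) u)
      = of_bool (\<phi> g w = y) - of_bool (\<phi> g w = x)"
    using c_boundary[OF E] by simp
qed

text \<open>
  The classes of the equivalence relation generated by \<open>link j\<close> are the connected components of the
  quotient of the graph of thick edges.
\<close>

definition link :: "nat \<Rightarrow> ('b \<times> 'b) set" where
  "link j = thick j \<union> {(x, y)\<in>E \<times> E. y \<in> orbit G \<phi> x}"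

lemma thick_flux_linked:
  assumes "(x, y) \<in> (link j)\<^sup>*" and "x \<in> E" "w \<in> E"
  shows "thick_flux j w x y = (\<Sum>g\<in>carrier G. of_bool (\<phi> g w = y) - of_bool (\<phi> g w = x))"
    (is "_ = ?rhs x y")
  using assms(1)
proof (induction rule: rtrancl_induct)
  case base
  show ?case using thick_flux_add[of w x x x j] assms by simp
next
  case (step y z)
  have E: "y \<in> E" "z \<in> E" using step(2) by (auto simp: link_def thick_def)
  have "thick_flux j w y z = ?rhs y z"
  proof (cases "(y, z) \<in> thick j")
    case True
    then show ?thesis using thick_flux_thick_edge assms by blast
  next
    case False
    then obtain h where h: "h \<in> carrier G" "z = \<phi> h y" using step(2) by (auto simp: link_def orbit_def)
    have "(\<Sum>g\<in>carrier G. of_bool (\<phi> g w = z)) = (\<Sum>g\<in>carrier G. of_bool (\<phi> (h \<otimes> g) w = z))"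
      by (rule sum.reindex_bij_betw[OF bij_left_mult[OF h(1)], symmetric])
    also have "\<dots> = (\<Sum>g\<in>carrier G. of_bool (\<phi> g w = y) :: int)"
      using h E assms act_closed by (intro sum.cong) (auto simp: act_mult act_inj)
    finally have "?rhs y z = 0" by (simp add: sum_subtractf)
    then show ?thesis using thick_flux_orbit h E assms by simp
  qed
  then show ?case using thick_flux_add[of w x y z j] step assms E by (simp add: sum_subtractf)
qed

text \<open>
  This computes the trace on coinvariants as the number of orbits minus the number of components.  With
  \<open>\<rho>\<close> constant on components, a thick edge \<open>(u, v)\<close> has \<open>c u v = c (\<rho> v) v - c (\<rho> u) u\<close>, so the
  trace collects into the fluxes of the chains from \<open>\<rho> w\<close> to \<open>w\<close>.
\<close>

lemma weighted_trace_via_representatives: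
  assumes rep: "\<And>w. w \<in> E \<Longrightarrow> \<rho> w \<in> E \<and> (\<rho> w, w) \<in> (link j)\<^sup>*"
    and const: "\<And>u v. (u, v) \<in> thick j \<Longrightarrow> \<rho> u = \<rho> v"
  shows "weighted_trace j
           = (\<Sum>w\<in>E. \<Sum>g\<in>carrier G. of_bool (\<phi> g w = w) - of_bool (\<phi> g w = \<rho> w))"
proof -
  let ?t = "\<lambda>u v. of_bool ((u, v) \<in> thick j) :: int"
  have thickE: "u \<in> E" "v \<in> E" if "(u, v) \<in> thick j" for u v using that by (auto simp: thick_def)
  have "(\<Sum>(u, v)\<in>thick j. c u v (\<phi> g u) (\<phi> g v))
      = (\<Sum>w\<in>E. (\<Sum>u\<in>E. ?t u (\<phi> g w) * c (\<rho> w) w u (\<phi> g w)) - (\<Sum>u\<in>E. ?t (\<phi> g w) u * c (\<rho> w) w (\<phi> g w) u))"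
    if g: "g \<in> carrier G" for g
  proof -
    have "(\<Sum>(u, v)\<in>thick j. c u v (\<phi> g u) (\<phi> g v))
        = (\<Sum>(u, v)\<in>E \<times> E. ?t u v * c u v (\<phi> g u) (\<phi> g v))"
      by (rule sum.mono_neutral_cong_left) (use thickE in \<open>auto simp: finite_E\<close>)
    also have "\<dots> = (\<Sum>u\<in>E. \<Sum>v\<in>E. ?t u v * c u v (\<phi> g u) (\<phi> g v))"
      by (simp add: sum.cartesian_product)
    also have "\<dots> = (\<Sum>u\<in>E. \<Sum>v\<in>E. ?t u v * c (\<rho> v) v (\<phi> g u) (\<phi> g v) - ?t u v * c (\<rho> u) u (\<phi> g u) (\<phi> g v))"
    proof (intro sum.cong[OF refl])
      fix u v assume uv: "u \<in> E" "v \<in> E"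
      show "?t u v * c u v (\<phi> g u) (\<phi> g v)
          = ?t u v * c (\<rho> v) v (\<phi> g u) (\<phi> g v) - ?t u v * c (\<rho> u) u (\<phi> g u) (\<phi> g v)"
      proof (cases "(u, v) \<in> thick j")
        case True
        have "c (\<rho> u) v (\<phi> g u) (\<phi> g v) = c (\<rho> u) u (\<phi> g u) (\<phi> g v) + c u v (\<phi> g u) (\<phi> g v)"
          by (rule c_add) (use uv rep act_closed g in blast)+
        then show ?thesis using True const by simp
      qed simp
    qed
    also have "\<dots> = (\<Sum>v\<in>E. \<Sum>u\<in>E. ?t u v * c (\<rho> v) v (\<phi> g u) (\<phi> g v))
        - (\<Sum>u\<in>E. \<Sum>v\<in>E. ?t u v * c (\<rho> u) u (\<phi> g u) (\<phi> g v))"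
      by (simp add: sum_subtractf) (rule sum.swap)
    also have "\<dots> = (\<Sum>v\<in>E. \<Sum>u\<in>E. ?t (\<phi> g u) (\<phi> g v) * c (\<rho> v) v (\<phi> g u) (\<phi> g v))
        - (\<Sum>u\<in>E. \<Sum>v\<in>E. ?t (\<phi> g u) (\<phi> g v) * c (\<rho> u) u (\<phi> g u) (\<phi> g v))"
      by (intro arg_cong2[where f="(-)"] sum.cong[OF refl]) (simp_all add: thick_act[OF g])
    also have "\<dots> = (\<Sum>v\<in>E. \<Sum>u\<in>E. ?t u (\<phi> g v) * c (\<rho> v) v u (\<phi> g v))
        - (\<Sum>u\<in>E. \<Sum>v\<in>E. ?t (\<phi> g u) v * c (\<rho> u) u (\<phi> g u) v)"
    proof (rule arg_cong2[where f="(-)"]; rule sum.cong[OF refl])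
      fix v
      show "(\<Sum>u\<in>E. ?t (\<phi> g u) (\<phi> g v) * c (\<rho> v) v (\<phi> g u) (\<phi> g v)) = (\<Sum>u\<in>E. ?t u (\<phi> g v) * c (\<rho> v) v u (\<phi> g v))"
        by (rule sum.reindex_bij_betw[OF bij_act[OF g]])
      show "(\<Sum>u\<in>E. ?t (\<phi> g v) (\<phi> g u) * c (\<rho> v) v (\<phi> g v) (\<phi> g u)) = (\<Sum>u\<in>E. ?t (\<phi> g v) u * c (\<rho> v) v (\<phi> g v) u)"
        by (rule sum.reindex_bij_betw[OF bij_act[OF g]])
    qed
    finally show ?thesis by (simp add: sum_subtractf)
  qed
  then have "weighted_trace j = (\<Sum>g\<in>carrier G. \<Sum>w\<in>E.
      (\<Sum>u\<in>E. ?t u (\<phi> g w) * c (\<rho> w) w u (\<phi> g w)) - (\<Sum>u\<in>E. ?t (\<phi> g w) u * c (\<rho> w) w (\<phi> g w) u))"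
    unfolding weighted_trace_eq_sum_twisted by (intro sum.cong) auto
  also have "\<dots> = (\<Sum>w\<in>E. thick_flux j w (\<rho> w) w)"
    unfolding thick_flux_def by (rule sum.swap)
  also have "\<dots> = (\<Sum>w\<in>E. \<Sum>g\<in>carrier G. of_bool (\<phi> g w = w) - of_bool (\<phi> g w = \<rho> w))"
    by (intro sum.cong refl thick_flux_linked) (use rep in auto)
  finally show ?thesis .
qed

end

section \<open>A bicombing forces a fixed point\<close>

text \<open>
  Writing \<open>1/n\<close> through the conditions \<open>j \<le> n\<close> converts a sum over edges weighted by the inverse order
  of the stabilizer into the traces over the filtration \<open>thick\<close>.
\<close>

lemma inverse_eq_telescoping_sum:
  fixes n N :: nat
  assumes "1 \<le> n" "n \<le> N"
  shows "1 / real n = 1 - (\<Sum>j\<in>{2..N}. of_bool (j \<le> n) / (real j * (real j - 1)))"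
proof -
  have "(\<Sum>j\<in>{2..N}. of_bool (j \<le> n) / (real j * (real j - 1))) = (\<Sum>j\<in>{2..n}. 1 / (real j * (real j - 1)))"
    by (rule sum.mono_neutral_cong_right) (use assms in auto)
  also have "\<dots> = 1 - 1 / real n"
    using assms(1)
  proof (induction n rule: dec_induct)
    case (step n)
    then have "{2..Suc n} = insert (Suc n) {2..n}" by auto
    then have "(\<Sum>j\<in>{2..Suc n}. 1 / (real j * (real j - 1)))
        = 1 / (real (Suc n) * (real (Suc n) - 1)) + (1 - 1 / real n)"
      using step.IH by simp
    also have "\<dots> = 1 - 1 / real (Suc n)"
    proof -
      have "real n + real n * real n > 0" "real n > 0" using step(1) by (auto intro: add_pos_nonneg)
      then show ?thesis by (simp add: field_simps)
    qed
    finally show ?case .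
  qed simp
  finally show ?thesis by simp
qed

lemma (in group) proper_subgroup_card:
  assumes "subgroup H G" "subgroup K G" "H \<subset> K" "finite K"
  shows "2 * card H \<le> card K"
proof -
  interpret K: group "G\<lparr>carrier := K\<rparr>" using assms(2) by (rule subgroup_imp_group)
  have "subgroup H (G\<lparr>carrier := K\<rparr>)"
    using assms subgroup_incl by blast
  then have "card (rcosets\<^bsub>G\<lparr>carrier := K\<rparr>\<^esub> H) * card H = card K"
    using K.lagrange by (simp add: order_def)
  moreover have "card H < card K" using assms(3,4) by (rule psubset_card_mono[rotated])
  ultimately have "card (rcosets\<^bsub>G\<lparr>carrier := K\<rparr>\<^esub> H) > 1"
    by (metis One_nat_def less_one linorder_neqE_nat mult_1 mult_is_0 nat_less_le not_less_zero)
  then show ?thesis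
    using \<open>_ * card H = card K\<close> by (metis Suc_1 Suc_leI mult_le_mono1)
qed

context equivariant_bicombing
begin

lemma edge_stabilizer_same: "edge_stabilizer x x = stabilizer G \<phi> x"
  by (simp add: edge_stabilizer_def)

lemma card_stabilizer_orbit:
  assumes "x \<in> E" "y \<in> orbit G \<phi> x"
  shows "card (stabilizer G \<phi> y) = card (stabilizer G \<phi> x)"
proof -
  obtain h where h: "h \<in> carrier G" "y = \<phi> h x" using assms(2) by (auto simp: orbit_def)
  have "j \<le> card (stabilizer G \<phi> y) \<longleftrightarrow> j \<le> card (stabilizer G \<phi> x)" for j
    using thick_act[OF h(1) assms(1) assms(1), of j] assms(1) act_closed[OF h(1) assms(1)] h
    by (simp add: thick_def edge_stabilizer_same)
  then show ?thesis by (metis order_antisym order_refl)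
qed

lemma orbit_in: "x \<in> E \<Longrightarrow> y \<in> orbit G \<phi> x \<Longrightarrow> y \<in> E"
  using act_closed by (auto simp: orbit_def)

lemma finite_stabilizer: "finite (stabilizer G \<phi> x)"
  using finite_edge_stabilizer[of x x] by (simp add: edge_stabilizer_same)

text \<open>
  Let \<open>y = h x\<close>.  Then \<open>h\<close> normalizes the common stabilizer \<open>S\<close> of \<open>x\<close> and \<open>y\<close>, so some \<open>z\<close> is fixed
  by \<open>S\<close> and \<open>h\<close>.  By maximality \<open>z\<close> is in the orbit of \<open>x\<close>, its stabilizer is no larger than \<open>S\<close>,
  and \<open>h \<in> S\<close>.
\<close>

lemma eq_if_stabilizer_subset:
  assumes maximal: "\<And>x y. \<lbrakk>x \<in> E; y \<in> E; stabilizer G \<phi> x \<subseteq> stabilizer G \<phi> y\<rbrakk> \<Longrightarrow> y \<in> orbit G \<phi> x"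
    and x: "x \<in> E" and y: "y \<in> E" and sub: "stabilizer G \<phi> x \<subseteq> stabilizer G \<phi> y"
  shows "x = y"
proof -
  interpret group G by (rule group_G)
  let ?S = "stabilizer G \<phi> x"
  have eq: "stabilizer G \<phi> z = ?S" if "z \<in> E" "?S \<subseteq> stabilizer G \<phi> z" for z
    using card_stabilizer_orbit[OF x maximal[OF x that]] that(2) finite_stabilizer
    by (metis card_subset_eq)
  obtain h where h: "h \<in> carrier G" "y = \<phi> h x"
    using maximal[OF x y sub] by (auto simp: orbit_def)
  have S: "?S \<subseteq> carrier G" by (auto simp: stabilizer_def)
  have ne: "fixed ?S \<noteq> {}" using x by (auto simp: fixed_def stabilizer_def)
  have "\<phi> h ` fixed ?S \<subseteq> fixed ?S"
  proof (rule translate_fixed[OF S h(1)])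
    fix a assume a: "a \<in> ?S"
    then have aG: "a \<in> carrier G" using S by blast
    have "\<phi> a (\<phi> h x) = \<phi> h x" using a eq[OF y sub] h by (auto simp: stabilizer_def)
    then show "inv h \<otimes> (a \<otimes> h) \<in> ?S"
      using act_conjugate[OF x aG h(1)] aG h(1) by (simp add: stabilizer_def)
  qed
  then obtain z where z: "z \<in> fixed (insert h ?S)"
    using invariant_fixed_set_contains_fixed_point[OF S ne h(1)] by blast
  then have "z \<in> E" "?S \<subseteq> stabilizer G \<phi> z" "h \<in> stabilizer G \<phi> z"
    using S h by (auto simp: fixed_def stabilizer_def)
  then have "h \<in> ?S" using eq by blast
  then show ?thesis using h by (simp add: stabilizer_def)
qed

text \<open>
  Points with small stabilizers are isolated in the quotient: an edge from such a point to a different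
  one has a stabilizer of index at least two in the stabilizer of the point, so it is not thick.
\<close>

lemma linked_imp_same_orbit:
  assumes reduced: "\<And>x y. \<lbrakk>x \<in> E; y \<in> E; stabilizer G \<phi> x \<subseteq> stabilizer G \<phi> y\<rbrakk> \<Longrightarrow> x = y"
    and w: "w \<in> E" "card (stabilizer G \<phi> w) < 2 * j" and "(z, w) \<in> (link j)\<^sup>*"
  shows "z \<in> orbit G \<phi> w"
  using assms(4)
proof (induction rule: converse_rtrancl_induct)
  case base
  show ?case using orbit_refl w by blast
next
  case (step z z')
  have E: "z \<in> E" "z' \<in> E" using step(1) by (auto simp: link_def thick_def)
  show ?case
  proof (cases "z' \<in> orbit G \<phi> z")
    case True
    then show ?thesis using step(3) E w orbit_sym orbit_trans by blast
  next
    case False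
    then have le: "j \<le> card (edge_stabilizer z z')" using step(1) by (auto simp: link_def thick_def)
    have "z \<noteq> z'" using False orbit_refl E by blast
    then have "\<not> stabilizer G \<phi> z' \<subseteq> stabilizer G \<phi> z" using reduced E by blast
    then have "edge_stabilizer z z' \<subset> stabilizer G \<phi> z'" by (auto simp: edge_stabilizer_def)
    then have "2 * card (edge_stabilizer z z') \<le> card (stabilizer G \<phi> z')"
      using group.proper_subgroup_card[OF group_G] subgroup_edge_stabilizer stabilizer_subgroup
        finite_stabilizer E by blast
    then show ?thesis using le w(2) card_stabilizer_orbit[OF w(1) step(3)] by simp
  qed
qed

lemma link_sym: "(x, y) \<in> link j \<Longrightarrow> (y, x) \<in> link j"
  using orbit_sym by (auto simp: link_def thick_def edge_stabilizer_def Int_commute)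

text \<open>
  The component of the orbit of \<open>x0\<close> is represented by \<open>x0\<close>, which keeps that orbit out of the
  bound.  Orbits with small stabilizers are components of their own and contribute zero.
\<close>

lemma weighted_trace_le:
  assumes reduced: "\<And>x y. \<lbrakk>x \<in> E; y \<in> E; stabilizer G \<phi> x \<subseteq> stabilizer G \<phi> y\<rbrakk> \<Longrightarrow> x = y"
    and x0: "x0 \<in> E"
  shows "weighted_trace j \<le> (\<Sum>w\<in>{w\<in>E - orbit G \<phi> x0. 2 * j \<le> card (stabilizer G \<phi> w)}.
            int (card (stabilizer G \<phi> w)))"
proof -
  define \<rho> where "\<rho> w = (if (x0, w) \<in> (link j)\<^sup>* then x0 else SOME z. (z, w) \<in> (link j)\<^sup>*)" for w
  have sym: "(y, x) \<in> (link j)\<^sup>*" if "(x, y) \<in> (link j)\<^sup>*" for x y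
    using that sym_rtrancl[of "link j"] link_sym by (meson symD symI)
  have \<rho>: "(\<rho> w, w) \<in> (link j)\<^sup>*" for w
    unfolding \<rho>_def by (auto intro: someI[of "\<lambda>z. (z, w) \<in> (link j)\<^sup>*" w])
  have \<rho>E: "\<rho> w \<in> E" if "w \<in> E" for w
  proof -
    have "z \<in> E" if "(w, z) \<in> (link j)\<^sup>*" for z
      using that by (induction rule: rtrancl_induct) (use \<open>w \<in> E\<close> in \<open>auto simp: link_def thick_def\<close>)
    then show ?thesis using sym \<rho> by blast
  qed
  have const: "\<rho> u = \<rho> v" if "(u, v) \<in> thick j" for u v
  proof -
    have uv: "(u, v) \<in> (link j)\<^sup>*" using that by (auto simp: link_def)
    then have "(z, u) \<in> (link j)\<^sup>* \<longleftrightarrow> (z, v) \<in> (link j)\<^sup>*" for z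
      using sym by (meson rtrancl_trans)
    then show ?thesis by (simp add: \<rho>_def)
  qed
  let ?S = "{w\<in>E - orbit G \<phi> x0. 2 * j \<le> card (stabilizer G \<phi> w)}"
  let ?s = "\<lambda>w. \<Sum>g\<in>carrier G. of_bool (\<phi> g w = w) - of_bool (\<phi> g w = \<rho> w) :: int"
  have s_eq: "?s w = int (card (stabilizer G \<phi> w)) - (\<Sum>g\<in>carrier G. of_bool (\<phi> g w = \<rho> w))" for w
    using finite_G by (simp add: sum_subtractf stabilizer_def of_bool_def sum.If_cases Int_def)
  have orb: "?s w = 0" if w: "w \<in> E" "w \<notin> ?S" for w
  proof -
    have "\<rho> w \<in> orbit G \<phi> w"
    proof (cases "w \<in> orbit G \<phi> x0")
      case True
      then have "(x0, w) \<in> (link j)\<^sup>*" using w x0 by (auto simp: link_def)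
      then show ?thesis using orbit_sym[OF x0 w(1) True] by (simp add: \<rho>_def)
    next
      case False
      then have "card (stabilizer G \<phi> w) < 2 * j" using w by simp
      from linked_imp_same_orbit[OF reduced w(1) this \<rho>] show ?thesis .
    qed
    then obtain h where h: "h \<in> carrier G" "\<rho> w = \<phi> h w" by (auto simp: orbit_def)
    have "(\<Sum>g\<in>carrier G. of_bool (\<phi> g w = \<rho> w)) = (\<Sum>g\<in>carrier G. of_bool (\<phi> (h \<otimes> g) w = \<rho> w))"
      by (rule sum.reindex_bij_betw[OF bij_left_mult[OF h(1)], symmetric])
    also have "\<dots> = (\<Sum>g\<in>carrier G. of_bool (\<phi> g w = w) :: int)"
      using h w act_closed by (intro sum.cong) (auto simp: act_mult act_inj)
    finally show ?thesis by (simp add: sum_subtractf)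
  qed
  have "weighted_trace j = (\<Sum>w\<in>E. ?s w)"
    by (rule weighted_trace_via_representatives) (use \<rho> \<rho>E const in auto)
  also have "\<dots> = (\<Sum>w\<in>?S. ?s w)"
    by (rule sum.mono_neutral_right) (use finite_E orb in auto)
  also have "\<dots> \<le> (\<Sum>w\<in>?S. int (card (stabilizer G \<phi> w)))"
    unfolding s_eq by (intro sum_mono) (simp add: sum_nonneg)
  finally show ?thesis .
qed

lemma thick_1: "thick (Suc 0) = E \<times> E"
proof -
  have "Suc 0 \<le> card (edge_stabilizer u v)" if "u \<in> E" "v \<in> E" for u v
    using subgroup.one_closed[OF subgroup_edge_stabilizer[OF that]] finite_edge_stabilizer
    by (metis Suc_leI card_gt_0_iff empty_iff)
  then show ?thesis by (auto simp: thick_def)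
qed

lemma weighted_trace_1_eq_fixed:
  assumes "E \<noteq> {}"
  shows "weighted_trace 1 = (\<Sum>g\<in>carrier G. int (card (fixed {g})) - 1)"
proof -
  have "(\<Sum>(u, v)\<in>E \<times> E. c u v (\<phi> g u) (\<phi> g v)) = int (card (fixed {g})) - 1"
    if g: "g \<in> carrier G" for g
  proof -
    have "fixed {} = E" by (simp add: fixed_def)
    then show ?thesis
      using trace_on_fixed_set[of "{}" g] g assms act_closed
      by (force simp: sum.cartesian_product fixed_insert[of g "{}"])
  qed
  then show ?thesis
    by (simp add: weighted_trace_eq_sum_twisted thick_1)
qed

text \<open>
  Since all edges are thick here, this is \<open>\<bar>G\<bar>\<close> times the number of orbits other than that of
  \<open>x0\<close>, with \<open>\<bar>G\<bar>\<close> spread over the points of each orbit.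
\<close>

lemma weighted_trace_1_eq_stabilizers:
  assumes x0: "x0 \<in> E"
  shows "weighted_trace 1 = (\<Sum>w\<in>E - orbit G \<phi> x0. int (card (stabilizer G \<phi> w)))"
proof -
  have "(\<Sum>g\<in>carrier G. int (card (fixed {g}))) = (\<Sum>g\<in>carrier G. \<Sum>w\<in>E. of_bool (\<phi> g w = w))"
    using finite_E by (intro sum.cong) (auto simp: fixed_def of_bool_def sum.If_cases Int_def)
  also have "\<dots> = (\<Sum>w\<in>E. \<Sum>g\<in>carrier G. of_bool (\<phi> g w = w))" by (rule sum.swap)
  also have "\<dots> = (\<Sum>w\<in>E. int (card (stabilizer G \<phi> w)))"
    using finite_G by (intro sum.cong) (auto simp: stabilizer_def of_bool_def sum.If_cases Int_def)
  also have "\<dots> = (\<Sum>w\<in>E - orbit G \<phi> x0. int (card (stabilizer G \<phi> w)))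
      + (\<Sum>w\<in>orbit G \<phi> x0. int (card (stabilizer G \<phi> w)))"
    by (rule sum.subset_diff) (use orbit_in x0 finite_E in auto)
  also have "(\<Sum>w\<in>orbit G \<phi> x0. int (card (stabilizer G \<phi> w))) = int (order G)"
    using card_stablizer_sum[OF finite_G, of "orbit G \<phi> x0"] x0
    by (auto simp: orbits_def simp flip: of_nat_sum)
  finally show ?thesis
    using x0 by (subst weighted_trace_1_eq_fixed) (auto simp: sum_subtractf order_def)
qed

lemma card_as_weighted_traces:
  assumes "E \<noteq> {}"
  shows "real (card E) - 1 = real_of_int (weighted_trace 1)
           - (\<Sum>j\<in>{2..order G}. real_of_int (weighted_trace j) / (real j * (real j - 1)))"
proof -
  interpret group G by (rule group_G)
  let ?t = "\<lambda>j. real j * (real j - 1)" and ?s = "\<lambda>u v. card (edge_stabilizer u v)"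
  have s: "1 \<le> ?s u v" "?s u v \<le> order G" if "(u, v) \<in> E \<times> E" for u v
    using that thick_1 card_mono[OF finite_G edge_stabilizer_subset] by (auto simp: thick_def order_def)
  have wt: "real_of_int (weighted_trace j) = (\<Sum>(u, v)\<in>E \<times> E. of_bool (j \<le> ?s u v) * (real (?s u v) * c u v u v))" for j
    unfolding weighted_trace_def of_int_sum
    by (rule sum.mono_neutral_cong_left) (auto simp: thick_def finite_E)
  have "(\<Sum>(u, v)\<in>E \<times> E. c u v u v) = int (card E) - 1"
  proof -
    have "fixed {} = E" by (simp add: fixed_def)
    moreover have "{z\<in>E. \<phi> \<one> z = z} = E" using act_one by auto
    moreover have "(\<Sum>(u, v)\<in>E \<times> E. c u v u v) = (\<Sum>(u, v)\<in>E \<times> E. c u v (\<phi> \<one> u) (\<phi> \<one> v))"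
      using act_one by (intro sum.cong) auto
    ultimately show ?thesis
      using trace_on_fixed_set[of "{}" \<one>] assms act_closed by (force simp: sum.cartesian_product)
  qed
  then have "real (card E) - 1 = real_of_int (\<Sum>(u, v)\<in>E \<times> E. c u v u v)" by simp
  also have "\<dots> = (\<Sum>(u, v)\<in>E \<times> E. (real (?s u v) * c u v u v) * (1 / real (?s u v)))"
    unfolding of_int_sum using s by (intro sum.cong) (fastforce simp: not_le)+
  also have "\<dots> = (\<Sum>(u, v)\<in>E \<times> E. (real (?s u v) * c u v u v)
      - (\<Sum>j\<in>{2..order G}. of_bool (j \<le> ?s u v) * (real (?s u v) * c u v u v) / ?t j))"
  proof (rule sum.cong[OF refl], clarify)
    fix u v assume "u \<in> E" "v \<in> E"
    then have "1 / real (?s u v) = 1 - (\<Sum>j\<in>{2..order G}. of_bool (j \<le> ?s u v) / ?t j)"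
      using inverse_eq_telescoping_sum s by blast
    then show "(real (?s u v) * c u v u v) * (1 / real (?s u v)) = (real (?s u v) * c u v u v)
      - (\<Sum>j\<in>{2..order G}. of_bool (j \<le> ?s u v) * (real (?s u v) * c u v u v) / ?t j)"
      by (simp only: right_diff_distrib sum_distrib_left mult_1_right times_divide_eq_right mult.commute)
  qed
  also have "\<dots> = (\<Sum>(u, v)\<in>E \<times> E. real (?s u v) * c u v u v)
      - (\<Sum>j\<in>{2..order G}. (\<Sum>(u, v)\<in>E \<times> E. of_bool (j \<le> ?s u v) * (real (?s u v) * c u v u v)) / ?t j)"
    unfolding sum_divide_distrib case_prod_unfold sum_subtractf by (subst sum.swap) simp
  also have "(\<Sum>(u, v)\<in>E \<times> E. real (?s u v) * c u v u v) = real_of_int (weighted_trace 1)"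
    unfolding wt using s by (intro sum.cong) auto
  finally show ?thesis unfolding wt .
qed

text \<open>
  The equality for \<open>j = 1\<close> and the bounds for \<open>j \<ge> 2\<close> enter the formula for \<open>\<bar>E\<bar> - 1\<close> with
  opposite signs, so together they bound \<open>\<bar>E\<bar> - 1\<close> from below.  The maximality hypothesis says that
  no orbit of \<open>E\<close> can be dropped without losing a fixed point of some stabilizer.
\<close>

theorem fixed_point:
  assumes "E \<noteq> {}"
    and maximal: "\<And>x y. \<lbrakk>x \<in> E; y \<in> E; stabilizer G \<phi> x \<subseteq> stabilizer G \<phi> y\<rbrakk> \<Longrightarrow> y \<in> orbit G \<phi> x"
  shows "\<exists>x\<in>E. stabilizer G \<phi> x = carrier G"
proof -
  interpret group G by (rule group_G)
  let ?s = "\<lambda>w. card (stabilizer G \<phi> w)" and ?t = "\<lambda>j. real j * (real j - 1)"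
  have reduced: "x = y" if "x \<in> E" "y \<in> E" "stabilizer G \<phi> x \<subseteq> stabilizer G \<phi> y" for x y
    using eq_if_stabilizer_subset maximal that by blast
  have s: "1 \<le> ?s w" "?s w \<le> order G" if "w \<in> E" for w
  proof -
    show "1 \<le> ?s w" using stabilizer_one_closed[OF that] finite_stabilizer
      by (metis One_nat_def Suc_leI card_gt_0_iff empty_iff)
    show "?s w \<le> order G" using finite_G by (auto simp: order_def stabilizer_def intro: card_mono)
  qed
  obtain x0 where x0: "x0 \<in> E" and x0_max: "\<And>w. w \<in> E \<Longrightarrow> ?s w \<le> ?s x0"
  proof -
    have "Max (?s ` E) \<in> ?s ` E" using assms finite_E by (intro Max_in) auto
    then obtain x where "x \<in> E" "?s x = Max (?s ` E)" by auto
    then show thesis using that[of x] finite_E by auto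
  qed
  define B where "B = E - orbit G \<phi> x0"
  have finB: "finite B" and BE: "B \<subseteq> E" using finite_E by (auto simp: B_def)
  have tr1: "weighted_trace 1 = (\<Sum>w\<in>B. int (?s w))"
    unfolding B_def by (rule weighted_trace_1_eq_stabilizers[OF x0])
  have tr_le: "weighted_trace j \<le> (\<Sum>w\<in>B. of_bool (2 * j \<le> ?s w) * int (?s w))" for j
  proof -
    have "(\<Sum>w\<in>{w\<in>B. 2 * j \<le> ?s w}. int (?s w)) = (\<Sum>w\<in>B. of_bool (2 * j \<le> ?s w) * int (?s w))"
      by (rule sum.mono_neutral_cong_left) (use finB in auto)
    then show ?thesis using weighted_trace_le[OF reduced x0, of j] by (simp add: B_def)
  qed
  \<comment> \<open>otherwise the bound for \<open>j = 1\<close> would be smaller than the exact value\<close>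
  have s2: "2 \<le> ?s w" if "w \<in> B" for w
  proof (rule ccontr)
    assume "\<not> 2 \<le> ?s w"
    then have "(\<Sum>w\<in>B. of_bool (2 * 1 \<le> ?s w) * int (?s w)) < (\<Sum>w\<in>B. int (?s w))"
      using that s BE finB by (intro sum_strict_mono_ex1) (force intro!: bexI[of _ w])+
    then show False using tr_le[of 1] tr1 by linarith
  qed
  \<comment> \<open>\<open>j \<le> s div 2\<close> is the thickness condition \<open>2 * j \<le> s\<close> from the bound on the traces\<close>
  have "2 * real (card B) \<le> (\<Sum>w\<in>B. real (?s w) * (1 / real (?s w div 2)))"
  proof -
    have "2 \<le> real (?s w) * (1 / real (?s w div 2))" if "w \<in> B" for w
    proof -
      have "?s w div 2 > 0" "2 * (?s w div 2) \<le> ?s w" using s2[OF that] by auto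
      then have "2 * real (?s w div 2) \<le> real (?s w)" by (metis of_nat_le_iff of_nat_mult of_nat_numeral)
      then show ?thesis using \<open>?s w div 2 > 0\<close> by (simp add: field_simps)
    qed
    from sum_bounded_below[OF this] show ?thesis by (simp add: mult.commute)
  qed
  also have "\<dots> = (\<Sum>w\<in>B. real (?s w) - (\<Sum>j\<in>{2..order G}. of_bool (2 * j \<le> ?s w) * real (?s w) / ?t j))"
  proof (rule sum.cong[OF refl])
    fix w assume w: "w \<in> B"
    have "1 / real (?s w div 2) = 1 - (\<Sum>j\<in>{2..order G}. of_bool (j \<le> ?s w div 2) / ?t j)"
    proof (rule inverse_eq_telescoping_sum)
      show "1 \<le> ?s w div 2" using s2[OF w] by auto
      show "?s w div 2 \<le> order G" by (rule order_trans[OF div_le_dividend s(2)]) (use w BE in blast)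
    qed
    moreover have "j \<le> ?s w div 2 \<longleftrightarrow> 2 * j \<le> ?s w" for j by auto
    ultimately show "real (?s w) * (1 / real (?s w div 2))
        = real (?s w) - (\<Sum>j\<in>{2..order G}. of_bool (2 * j \<le> ?s w) * real (?s w) / ?t j)"
      by (simp only: right_diff_distrib sum_distrib_left mult_1_right times_divide_eq_right mult.commute)
  qed
  also have "\<dots> = real_of_int (\<Sum>w\<in>B. int (?s w))
      - (\<Sum>j\<in>{2..order G}. real_of_int (\<Sum>w\<in>B. of_bool (2 * j \<le> ?s w) * int (?s w)) / ?t j)"
    unfolding sum_divide_distrib of_int_sum sum_subtractf by (subst sum.swap) simp
  also have "\<dots> \<le> real_of_int (weighted_trace 1)
      - (\<Sum>j\<in>{2..order G}. real_of_int (weighted_trace j) / ?t j)"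
    unfolding tr1 by (intro diff_left_mono sum_mono divide_right_mono of_int_le_iff[THEN iffD2] tr_le) auto
  also have "\<dots> = real (card E) - 1" by (rule card_as_weighted_traces[OF assms(1), symmetric])
  finally have "real (2 * card B + 1) \<le> real (card E)" by simp
  then have count: "2 * card B + 1 \<le> card E" by (simp only: of_nat_le_iff)
  have orb_sub: "orbit G \<phi> x0 \<subseteq> E" using orbit_in x0 by blast
  then have cardE: "card E = card B + card (orbit G \<phi> x0)"
    using card_Diff_subset[OF finite_subset[OF orb_sub finite_E] orb_sub] card_mono[OF finite_E orb_sub]
    by (simp add: B_def)
  have "B = {}"
  proof (rule ccontr)
    assume "B \<noteq> {}"
    then obtain b where b: "b \<in> B" by blast
    then have bE: "b \<in> E" "b \<notin> orbit G \<phi> x0" by (auto simp: B_def)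
    have "orbit G \<phi> b \<subseteq> B"
    proof
      fix y assume y: "y \<in> orbit G \<phi> b"
      then have yE: "y \<in> E" using orbit_in bE by blast
      have "y \<notin> orbit G \<phi> x0"
        using orbit_trans[OF x0 yE bE(1) _ orbit_sym[OF bE(1) yE y]] bE(2) by blast
      then show "y \<in> B" using yE by (simp add: B_def)
    qed
    then have "card (orbit G \<phi> b) \<le> card B" by (rule card_mono[OF finB])
    moreover have "card (orbit G \<phi> x0) \<le> card (orbit G \<phi> b)"
    proof -
      have "card (orbit G \<phi> x0) * ?s b \<le> card (orbit G \<phi> x0) * ?s x0" using x0_max bE by simp
      also have "\<dots> = card (orbit G \<phi> b) * ?s b"
        using orbit_stabilizer_theorem[OF x0] orbit_stabilizer_theorem[OF bE(1)] by simp
      finally show ?thesis using s(1)[OF bE(1)] by simp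
    qed
    ultimately show False using count cardE by linarith
  qed
  \<comment> \<open>the action is transitive, and no summand is negative, so every element fixes exactly one point\<close>
  then have sum0: "(\<Sum>g\<in>carrier G. int (card (fixed {g})) - 1) = 0"
    using tr1 weighted_trace_1_eq_fixed[OF assms(1)] by simp
  have "1 \<le> card (fixed {g})" if g: "g \<in> carrier G" for g
  proof -
    have "fixed {} = E" by (simp add: fixed_def)
    then have "fixed {g} \<noteq> {}"
      using invariant_fixed_set_contains_fixed_point[of "{}" g] g assms(1) act_closed by auto
    then show ?thesis using finite_fixed by (metis One_nat_def Suc_leI card_gt_0_iff)
  qed
  then have "int (card (fixed {\<one>})) - 1 = 0"
    using sum0 sum_nonneg_eq_0_iff[OF finite_G, of "\<lambda>g. int (card (fixed {g})) - 1"] by force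
  moreover have "fixed {\<one>} = E" using act_one by (auto simp: fixed_def)
  ultimately have "card E = 1" by simp
  then have "E = {x0}" using x0 by (metis card_1_singletonE singletonD)
  then have "stabilizer G \<phi> x0 = carrier G" using act_closed[OF _ x0] by (auto simp: stabilizer_def)
  then show ?thesis using x0 by blast
qed

end

section \<open>Lifting along epimorphisms of countable orbit modules\<close>

text \<open>
  Projectivity refers to modules with elements in a fixed type \<open>'u\<close>.  Modules over other types are copied
  into \<open>'u\<close> along injections \<open>j S\<close> of their carriers.
\<close>

definition transport_module ::
  "('g set set \<Rightarrow> 'a \<Rightarrow> 'b) \<Rightarrow> ('g, 'a) orbit_module \<Rightarrow> ('g, 'b) orbit_module" where
  "transport_module j M =
     \<lparr>mobj = (\<lambda>S. let i = inv_into (carrier (mobj M S)) (j S) in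
        \<lparr>carrier = j S ` carrier (mobj M S),
         monoid.mult = (\<lambda>a b. j S (i a \<otimes>\<^bsub>mobj M S\<^esub> i b)),
         one = j S \<one>\<^bsub>mobj M S\<^esub>\<rparr>),
      mmap = (\<lambda>S T f a. j S (mmap M S T f (inv_into (carrier (mobj M T)) (j T) a)))\<rparr>"

lemma is_orbit_moduleD:
  assumes "is_orbit_module G F M"
  shows "S \<in> orbit_obj G F \<Longrightarrow> comm_group (mobj M S)"
    and "\<lbrakk>S \<in> orbit_obj G F; T \<in> orbit_obj G F; f \<in> orbit_mor G S T\<rbrakk>
           \<Longrightarrow> mmap M S T f \<in> hom (mobj M T) (mobj M S)"
    and "\<lbrakk>S \<in> orbit_obj G F; x \<in> carrier (mobj M S)\<rbrakk> \<Longrightarrow> mmap M S S (restrict id S) x = x"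
    and "\<lbrakk>S \<in> orbit_obj G F; T \<in> orbit_obj G F; U \<in> orbit_obj G F; f \<in> orbit_mor G S T;
           g \<in> orbit_mor G T U; x \<in> carrier (mobj M U)\<rbrakk>
           \<Longrightarrow> mmap M S U (compose S g f) x = mmap M S T f (mmap M T U g x)"
  using assms unfolding is_orbit_module_def by blast+

lemma orbit_module_homD:
  assumes "\<eta> \<in> orbit_module_hom G F M N"
  shows "S \<in> orbit_obj G F \<Longrightarrow> \<eta> S \<in> hom (mobj M S) (mobj N S)"
    and "\<lbrakk>S \<in> orbit_obj G F; T \<in> orbit_obj G F; f \<in> orbit_mor G S T; x \<in> carrier (mobj M T)\<rbrakk>
           \<Longrightarrow> \<eta> S (mmap M S T f x) = mmap N S T f (\<eta> T x)"
  using assms unfolding orbit_module_hom_def by blast+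

context
  fixes G :: "('g, 'm) monoid_scheme" and F :: "'g set set"
    and M :: "('g, 'a) orbit_module" and j :: "'g set set \<Rightarrow> 'a \<Rightarrow> 'b"
  assumes M: "is_orbit_module G F M"
    and inj: "\<And>S. S \<in> orbit_obj G F \<Longrightarrow> inj_on (j S) (carrier (mobj M S))"
begin

lemma transport_carrier: "carrier (mobj (transport_module j M) S) = j S ` carrier (mobj M S)"
  by (simp add: transport_module_def Let_def)

lemma transport_inv_into:
  "\<lbrakk>S \<in> orbit_obj G F; x \<in> carrier (mobj M S)\<rbrakk> \<Longrightarrow> inv_into (carrier (mobj M S)) (j S) (j S x) = x"
  using inj by simp

lemma transport_mult:
  "\<lbrakk>S \<in> orbit_obj G F; x \<in> carrier (mobj M S); y \<in> carrier (mobj M S)\<rbrakk>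
     \<Longrightarrow> j S x \<otimes>\<^bsub>mobj (transport_module j M) S\<^esub> j S y = j S (x \<otimes>\<^bsub>mobj M S\<^esub> y)"
  by (simp add: transport_module_def Let_def transport_inv_into)

lemma transport_mmap:
  "\<lbrakk>T \<in> orbit_obj G F; x \<in> carrier (mobj M T)\<rbrakk>
     \<Longrightarrow> mmap (transport_module j M) S T f (j T x) = j S (mmap M S T f x)"
  by (simp add: transport_module_def transport_inv_into)

lemma is_orbit_module_transport: "is_orbit_module G F (transport_module j M)"
proof -
  let ?N = "transport_module j M"
  have "comm_group (mobj ?N S)" if S: "S \<in> orbit_obj G F" for S
  proof -
    interpret comm_group "mobj M S" using is_orbit_moduleD(1)[OF M S] .
    have one: "\<one>\<^bsub>mobj ?N S\<^esub> = j S \<one>\<^bsub>mobj M S\<^esub>" by (simp add: transport_module_def Let_def)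
    show ?thesis
    proof (rule comm_groupI)
      show "\<exists>y\<in>carrier (mobj ?N S). y \<otimes>\<^bsub>mobj ?N S\<^esub> a = \<one>\<^bsub>mobj ?N S\<^esub>" if a: "a \<in> carrier (mobj ?N S)" for a
      proof -
        obtain x where x: "x \<in> carrier (mobj M S)" "a = j S x" using a by (auto simp: transport_carrier)
        then have "j S (inv\<^bsub>mobj M S\<^esub> x) \<otimes>\<^bsub>mobj ?N S\<^esub> a = \<one>\<^bsub>mobj ?N S\<^esub>"
          using S by (simp add: transport_mult one)
        then show ?thesis using x by (auto simp: transport_carrier)
      qed
    qed (use S in \<open>auto simp: transport_carrier transport_mult one m_ac\<close>)
  qed
  moreover have "mmap ?N S T f \<in> hom (mobj ?N T) (mobj ?N S)"
    if ob: "S \<in> orbit_obj G F" "T \<in> orbit_obj G F" and f: "f \<in> orbit_mor G S T" for S T f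
  proof -
    note h = is_orbit_moduleD(2)[OF M ob f]
    interpret comm_group "mobj M T" using is_orbit_moduleD(1)[OF M ob(2)] .
    show ?thesis
      using ob hom_in_carrier[OF h] hom_mult[OF h]
      by (auto intro!: homI simp: transport_carrier transport_mult transport_mmap)
  qed
  ultimately show ?thesis
    using is_orbit_moduleD(3,4)[OF M] hom_in_carrier[OF is_orbit_moduleD(2)[OF M]]
    unfolding is_orbit_module_def by (auto simp: transport_carrier transport_mmap)
qed

lemma transport_hom: "j \<in> orbit_module_hom G F M (transport_module j M)"
  by (auto simp: orbit_module_hom_def transport_mmap transport_carrier transport_mult intro!: homI)

lemma transport_inverse_hom:
  "(\<lambda>S. inv_into (carrier (mobj M S)) (j S)) \<in> orbit_module_hom G F (transport_module j M) M"
proof -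
  have "inv_into (carrier (mobj M S)) (j S) \<in> hom (mobj (transport_module j M) S) (mobj M S)"
    if S: "S \<in> orbit_obj G F" for S
  proof -
    interpret comm_group "mobj M S" using is_orbit_moduleD(1)[OF M S] .
    show ?thesis using S by (auto intro!: homI simp: transport_carrier transport_mult transport_inv_into)
  qed
  then show ?thesis
    using hom_in_carrier[OF is_orbit_moduleD(2)[OF M]]
    by (auto simp: orbit_module_hom_def transport_carrier transport_mmap transport_inv_into)
qed

end

lemma orbit_module_hom_comp:
  assumes "is_orbit_module G F L"
    and "\<eta> \<in> orbit_module_hom G F L M" and "\<theta> \<in> orbit_module_hom G F M N"
  shows "(\<lambda>S x. \<theta> S (\<eta> S x)) \<in> orbit_module_hom G F L N"
proof -
  have "(\<lambda>x. \<theta> S (\<eta> S x)) \<in> hom (mobj L S) (mobj N S)" if "S \<in> orbit_obj G F" for S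
    using hom_compose[OF orbit_module_homD(1)[OF assms(2) that] orbit_module_homD(1)[OF assms(3) that]]
    by (simp add: o_def)
  then show ?thesis
    using orbit_module_homD(2)[OF assms(2)] orbit_module_homD(2)[OF assms(3)]
      hom_in_carrier[OF orbit_module_homD(1)[OF assms(2)]]
    unfolding orbit_module_hom_def by auto
qed

lemma infinite_inj_on_countable:
  assumes "countable (A :: 'a set)"
  shows "\<exists>j :: 'a \<Rightarrow> 'u::infinite. inj_on j A"
proof -
  obtain f :: "nat \<Rightarrow> 'u" where "inj f"
    using infinite_UNIV infinite_countable_subset by blast
  then have "inj_on (f \<circ> to_nat_on A) A"
    using assms by (intro comp_inj_on) (auto intro: inj_on_subset inj_on_to_nat_on)
  then show ?thesis by blast
qed

text \<open>
  Countable modules embed into every infinite universe \<open>'u\<close>, so a projective module over \<open>'u\<close> lifts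
  against epimorphisms of countable modules over arbitrary types.
\<close>

lemma projective_lifting:
  fixes P :: "('g, 'u::infinite) orbit_module"
    and M :: "('g, 'a) orbit_module" and N :: "('g, 'b) orbit_module"
  assumes P: "projective_orbit_module G F P"
    and M: "is_orbit_module G F M" and N: "is_orbit_module G F N"
    and countable_M: "\<And>S. S \<in> orbit_obj G F \<Longrightarrow> countable (carrier (mobj M S))"
    and countable_N: "\<And>S. S \<in> orbit_obj G F \<Longrightarrow> countable (carrier (mobj N S))"
    and \<epsilon>: "\<epsilon> \<in> orbit_module_hom G F M N" and surj: "orbit_module_surj G F M N \<epsilon>"
    and \<phi>: "\<phi> \<in> orbit_module_hom G F P N"
  obtains \<psi> where "\<psi> \<in> orbit_module_hom G F P M"
    and "\<And>S x. \<lbrakk>S \<in> orbit_obj G F; x \<in> carrier (mobj P S)\<rbrakk> \<Longrightarrow> \<epsilon> S (\<psi> S x) = \<phi> S x"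
proof -
  define j :: "'g set set \<Rightarrow> 'a \<Rightarrow> 'u" where "j S = (SOME j. inj_on j (carrier (mobj M S)))" for S
  define k :: "'g set set \<Rightarrow> 'b \<Rightarrow> 'u" where "k S = (SOME k. inj_on k (carrier (mobj N S)))" for S
  have j: "inj_on (j S) (carrier (mobj M S))" if "S \<in> orbit_obj G F" for S
    unfolding j_def using infinite_inj_on_countable[OF countable_M[OF that]] by (rule someI_ex)
  have k: "inj_on (k S) (carrier (mobj N S))" if "S \<in> orbit_obj G F" for S
    unfolding k_def using infinite_inj_on_countable[OF countable_N[OF that]] by (rule someI_ex)
  let ?M = "transport_module j M" and ?N = "transport_module k N"
  let ?i = "\<lambda>S. inv_into (carrier (mobj M S)) (j S)"
  define \<epsilon>' where "\<epsilon>' = (\<lambda>S x. k S (\<epsilon> S (?i S x)))"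
  have modM: "is_orbit_module G F ?M" and modN: "is_orbit_module G F ?N"
    using is_orbit_module_transport[OF M] j is_orbit_module_transport[OF N] k by blast+
  have modP: "is_orbit_module G F P" using P by (simp add: projective_orbit_module_def)
  have i: "?i \<in> orbit_module_hom G F ?M M" using transport_inverse_hom[OF M] j by blast
  have k_hom: "k \<in> orbit_module_hom G F N ?N" using transport_hom[OF N] k by blast
  have "\<epsilon>' \<in> orbit_module_hom G F ?M ?N"
    unfolding \<epsilon>'_def
    using orbit_module_hom_comp[OF modM orbit_module_hom_comp[OF modM i \<epsilon>] k_hom] .
  moreover have "orbit_module_surj G F ?M ?N \<epsilon>'"
  proof -
    have "\<epsilon>' S ` carrier (mobj ?M S) = carrier (mobj ?N S)" if S: "S \<in> orbit_obj G F" for S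
    proof -
      have "\<epsilon>' S ` carrier (mobj ?M S) = k S ` \<epsilon> S ` carrier (mobj M S)"
        by (simp add: \<epsilon>'_def transport_carrier[OF M] j image_image transport_inv_into[OF M _ S] S)
      also have "\<dots> = carrier (mobj ?N S)"
        using surj S by (simp add: orbit_module_surj_def transport_carrier[OF N] k)
      finally show ?thesis .
    qed
    then show ?thesis by (simp add: orbit_module_surj_def)
  qed
  moreover have "(\<lambda>S x. k S (\<phi> S x)) \<in> orbit_module_hom G F P ?N"
    by (rule orbit_module_hom_comp[OF modP \<phi> k_hom])
  ultimately have "\<exists>\<psi>\<in>orbit_module_hom G F P ?M.
      \<forall>S\<in>orbit_obj G F. \<forall>x\<in>carrier (mobj P S). \<epsilon>' S (\<psi> S x) = k S (\<phi> S x)"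
    using P[unfolded projective_orbit_module_def, THEN conjunct2, rule_format,
        of ?M ?N \<epsilon>' "\<lambda>S x. k S (\<phi> S x)"] modM modN by simp
  then obtain \<psi> where \<psi>: "\<psi> \<in> orbit_module_hom G F P ?M"
      and lift: "\<And>S x. \<lbrakk>S \<in> orbit_obj G F; x \<in> carrier (mobj P S)\<rbrakk> \<Longrightarrow> \<epsilon>' S (\<psi> S x) = k S (\<phi> S x)"
    by blast
  show thesis
  proof (rule that)
    show "(\<lambda>S x. ?i S (\<psi> S x)) \<in> orbit_module_hom G F P M"
      by (rule orbit_module_hom_comp[OF modP \<psi> i])
    fix S x assume S: "S \<in> orbit_obj G F" and x: "x \<in> carrier (mobj P S)"
    have "\<epsilon> S (?i S (\<psi> S x)) \<in> carrier (mobj N S)" "\<phi> S x \<in> carrier (mobj N S)"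
      using hom_in_carrier[OF orbit_module_homD(1)[OF orbit_module_hom_comp[OF modP \<psi>
              orbit_module_hom_comp[OF modM i \<epsilon>]] S] x]
        hom_in_carrier[OF orbit_module_homD(1)[OF \<phi> S] x] by auto
    then show "\<epsilon> S (?i S (\<psi> S x)) = \<phi> S x"
      using lift[OF S x] inj_onD[OF k[OF S]] by (simp add: \<epsilon>'_def)
  qed
qed

section \<open>Maps between transitive sets\<close>

locale finite_group_family = group G for G (structure) +
  fixes F :: "'a set set"
  assumes finite_G: "finite (carrier G)" and family: "subgroup_family G F"
begin

abbreviation "obj \<equiv> orbit_obj G F"

lemma family_subgroup: "H \<in> F \<Longrightarrow> subgroup H G"
  using family unfolding subgroup_family_def by blast

lemma family_subset: "H \<in> F \<Longrightarrow> H \<subseteq> carrier G"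
  using family_subgroup subgroup.subset by blast

lemma family_down: "\<lbrakk>H \<in> F; subgroup K G; K \<subseteq> H\<rbrakk> \<Longrightarrow> K \<in> F"
  using family unfolding subgroup_family_def by blast

lemma trivial_in_family: "{\<one>} \<in> F"
proof -
  obtain H where "H \<in> F" using family unfolding subgroup_family_def by blast
  then show ?thesis
    using family_down[of H "{\<one>}"] triv_subgroup subgroup.one_closed[OF family_subgroup] by blast
qed

lemma lcosets_obj: "H \<in> F \<Longrightarrow> lcosets H \<in> obj"
  by (auto simp: orbit_obj_def)

lemma objE:
  assumes "S \<in> obj"
  obtains H where "H \<in> F" "S = lcosets H"
  using assms unfolding orbit_obj_def by blast

lemma obj_cosetE:
  assumes "S \<in> obj" "C \<in> S"
  obtains H a where "H \<in> F" "S = lcosets H" "a \<in> carrier G" "C = a <# H"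
proof -
  obtain H where H: "H \<in> F" "S = lcosets H" using assms(1) by (rule objE)
  then obtain a where "a \<in> carrier G" "C = a <# H" using assms(2) unfolding LCOSETS_def by blast
  then show thesis using that H by blast
qed

lemma lcosetsI: "a \<in> carrier G \<Longrightarrow> a <# H \<in> lcosets H"
  unfolding LCOSETS_def by blast

lemma self_lcoset: "H \<in> F \<Longrightarrow> H \<in> lcosets H"
  using lcosetsI[OF one_closed, of H] lcos_mult_one[OF family_subset] by simp

lemma obj_subset:
  assumes "S \<in> obj" "C \<in> S"
  shows "C \<subseteq> carrier G"
proof -
  obtain H a where "H \<in> F" "a \<in> carrier G" "C = a <# H" using assms by (rule obj_cosetE)
  then show ?thesis using l_coset_subset_G[OF family_subset] by simp
qed

lemma obj_act:
  assumes "S \<in> obj" "C \<in> S" "g \<in> carrier G"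
  shows "g <# C \<in> S"
  using assms(1,2)
proof (rule obj_cosetE)
  fix H a assume H: "H \<in> F" "S = lcosets H" "a \<in> carrier G" "C = a <# H"
  then have "g <# C = (g \<otimes> a) <# H" using lcos_m_assoc[OF family_subset] assms(3) by simp
  then show ?thesis using H assms(3) lcosetsI by simp
qed

lemma obj_transitive:
  assumes "S \<in> obj" "C \<in> S" "D \<in> S"
  shows "\<exists>g\<in>carrier G. D = g <# C"
proof -
  obtain H where H: "H \<in> F" "S = lcosets H" using assms(1) by (rule objE)
  then obtain a b where ab: "a \<in> carrier G" "b \<in> carrier G" "C = a <# H" "D = b <# H"
    using assms(2,3) unfolding LCOSETS_def by blast
  then have "D = (b \<otimes> inv a) <# C"
    using lcos_m_assoc[OF family_subset[OF H(1)]] by (simp add: m_assoc)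
  then show ?thesis using ab by blast
qed

lemma act_one_lcos: "S \<in> obj \<Longrightarrow> C \<in> S \<Longrightarrow> \<one> <# C = C"
  using lcos_mult_one obj_subset by blast

lemma act_mult_lcos:
  "\<lbrakk>S \<in> obj; C \<in> S; g \<in> carrier G; h \<in> carrier G\<rbrakk> \<Longrightarrow> (g \<otimes> h) <# C = g <# (h <# C)"
  using lcos_m_assoc[OF obj_subset, of S C g h] by simp

lemma finite_obj: "S \<in> obj \<Longrightarrow> finite S"
  using finite_G by (elim objE) (simp add: LCOSETS_def)

definition stab :: "'a set \<Rightarrow> 'a set" where
  "stab C = {g \<in> carrier G. g <# C = C}"

text \<open>
  The stabilizer of \<open>a H\<close> is contained in the conjugate \<open>a H a\<^sup>-\<^sup>1\<close>.
\<close>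

lemma stab_obj:
  assumes "S \<in> obj" "C \<in> S"
  shows "stab C \<in> F"
proof -
  obtain H a where H: "H \<in> F" and a: "a \<in> carrier G" and C: "C = a <# H"
    using assms by (rule obj_cosetE)
  have conj: "(a <# H) #> inv a \<in> F" using family H a unfolding subgroup_family_def by blast
  have sub: "stab C \<subseteq> (a <# H) #> inv a"
  proof
    fix g assume g: "g \<in> stab C"
    then have gG: "g \<in> carrier G" by (simp add: stab_def)
    have "a \<in> C" using lcos_self[OF a family_subgroup[OF H]] C by simp
    then have "g \<otimes> a \<in> g <# C" by (auto simp: l_coset_def)
    then have "g \<otimes> a \<in> a <# H" using g C by (simp add: stab_def)
    moreover have "g = (g \<otimes> a) \<otimes> inv a" using gG a by (simp add: m_assoc)
    ultimately show "g \<in> (a <# H) #> inv a" by (auto simp: r_coset_def)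
  qed
  have "subgroup (stab C) G"
  proof (rule subgroupI)
    show "stab C \<subseteq> carrier G" by (auto simp: stab_def)
    show "stab C \<noteq> {}" using act_one_lcos[OF assms] by (auto simp: stab_def)
  next
    fix g assume g: "g \<in> stab C"
    then have "inv g <# C = inv g <# (g <# C)" by (simp add: stab_def)
    also have "\<dots> = C"
      using g act_mult_lcos[OF assms, of "inv g" g] act_one_lcos[OF assms] by (simp add: stab_def)
    finally show "inv g \<in> stab C" using g by (simp add: stab_def)
  next
    fix g h assume "g \<in> stab C" "h \<in> stab C"
    then show "g \<otimes> h \<in> stab C" using act_mult_lcos[OF assms, of g h] by (simp add: stab_def)
  qed
  then show ?thesis using family_down[OF conj] sub by blast
qed

lemma orbit_morD:
  assumes "f \<in> orbit_mor G S T"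
  shows "C \<in> S \<Longrightarrow> f C \<in> T" and "\<lbrakk>g \<in> carrier G; C \<in> S\<rbrakk> \<Longrightarrow> f (g <# C) = g <# f C"
  using assms by (simp_all add: orbit_mor_def PiE_iff)

text \<open>
  If \<open>H\<close> fixes \<open>D\<close>, this is the equivariant map \<open>G/H \<rightarrow> T\<close> with \<open>H \<mapsto> D\<close>: the setwise product
  \<open>(g H) D\<close> is \<open>g D\<close>.
\<close>

definition orbit_map :: "'a set \<Rightarrow> 'a set \<Rightarrow> 'a set \<Rightarrow> 'a set" where
  "orbit_map H D = (\<lambda>C\<in>lcosets H. C <#> D)"

lemma orbit_map_coset:
  assumes H: "H \<in> F" and T: "T \<in> obj" and D: "D \<in> T" "H \<subseteq> stab D" and g: "g \<in> carrier G"
  shows "orbit_map H D (g <# H) = g <# D"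
proof -
  have DG: "D \<subseteq> carrier G" using obj_subset T D by blast
  have "H <#> D = (\<Union>h\<in>H. h <# D)" unfolding set_mult_def l_coset_def by (rule refl)
  also have "\<dots> = (\<Union>h\<in>H. D)" using D(2) by (intro SUP_cong refl) (auto simp: stab_def)
  also have "\<dots> = D" using subgroup.one_closed[OF family_subgroup[OF H]] by blast
  finally have HD: "H <#> D = D" .
  have "(g <# H) <#> D = g <# (H <#> D)"
    unfolding l_coset_eq_set_mult by (rule set_mult_assoc) (use g family_subset[OF H] DG in auto)
  then show ?thesis using HD lcosetsI[OF g] by (simp add: orbit_map_def)
qed

lemma orbit_map_self:
  assumes "H \<in> F" and "T \<in> obj" and "D \<in> T" "H \<subseteq> stab D"
  shows "orbit_map H D H = D"
  using orbit_map_coset[OF assms one_closed]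
  by (simp only: lcos_mult_one[OF family_subset[OF assms(1)]] act_one_lcos[OF assms(2,3)])

lemma orbit_map_mor:
  assumes H: "H \<in> F" and T: "T \<in> obj" and D: "D \<in> T" "H \<subseteq> stab D"
  shows "orbit_map H D \<in> orbit_mor G (lcosets H) T"
proof -
  have "orbit_map H D (g <# C) = g <# orbit_map H D C" if gC: "g \<in> carrier G" "C \<in> lcosets H" for g C
  proof -
    obtain a where a: "a \<in> carrier G" "C = a <# H" using gC unfolding LCOSETS_def by blast
    then have "g <# C = (g \<otimes> a) <# H" using that lcos_m_assoc[OF family_subset[OF H] that(1) a(1)] by simp
    then show ?thesis
      using orbit_map_coset[OF assms a(1)] orbit_map_coset[OF assms, of "g \<otimes> a"] a that
        act_mult_lcos[OF T D(1) that(1) a(1)] by simp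
  qed
  moreover have "orbit_map H D C \<in> T" if C: "C \<in> lcosets H" for C
  proof -
    obtain a where "a \<in> carrier G" "C = a <# H" using C unfolding LCOSETS_def by blast
    then show ?thesis using orbit_map_coset[OF assms, of a] obj_act[OF T D(1), of a] by simp
  qed
  ultimately show ?thesis by (simp add: orbit_mor_def PiE_iff) (simp add: orbit_map_def)
qed

lemma orbit_mor_eqI:
  assumes H: "H \<in> F" and f: "f \<in> orbit_mor G (lcosets H) T" and f': "f' \<in> orbit_mor G (lcosets H) T"
    and eq: "f H = f' H"
  shows "f = f'"
proof (rule extensionalityI[of _ "lcosets H"])
  show "f \<in> extensional (lcosets H)" "f' \<in> extensional (lcosets H)"
    using f f' by (simp_all add: orbit_mor_def PiE_iff)
  fix C assume "C \<in> lcosets H"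
  then obtain a where "a \<in> carrier G" "C = a <# H" unfolding LCOSETS_def by blast
  then show "f C = f' C" using orbit_morD(2)[OF f, of a H] orbit_morD(2)[OF f', of a H] eq self_lcoset[OF H] by simp
qed

lemma compose_mor:
  assumes S: "S \<in> obj" and f: "f \<in> orbit_mor G S T" and g: "g \<in> orbit_mor G T U"
  shows "compose S g f \<in> orbit_mor G S U"
  unfolding orbit_mor_def
  by (simp add: compose_def PiE_iff orbit_morD[OF f] orbit_morD[OF g] obj_act[OF S])

lemma orbit_mor_stab:
  assumes "f \<in> orbit_mor G S T" "C \<in> S"
  shows "stab C \<subseteq> stab (f C)"
proof
  fix g assume "g \<in> stab C"
  then show "g \<in> stab (f C)"
    using orbit_morD(2)[OF assms(1) _ assms(2), of g] by (simp add: stab_def)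
qed

lemma compose_orbit_map:
  assumes K: "K \<in> F" and S: "S \<in> obj" and T: "T \<in> obj" and f: "f \<in> orbit_mor G S T"
    and D: "D \<in> S" "K \<subseteq> stab D"
  shows "compose (lcosets K) f (orbit_map K D) = orbit_map K (f D)"
proof (rule orbit_mor_eqI[OF K])
  note KD = orbit_map_mor[OF K S D]
  have fD: "f D \<in> T" "K \<subseteq> stab (f D)" using orbit_morD(1)[OF f] orbit_mor_stab[OF f] D by auto
  show "compose (lcosets K) f (orbit_map K D) \<in> orbit_mor G (lcosets K) T"
    by (rule compose_mor[OF lcosets_obj[OF K] KD f])
  show "orbit_map K (f D) \<in> orbit_mor G (lcosets K) T"
    by (rule orbit_map_mor[OF K T fD])
  show "compose (lcosets K) f (orbit_map K D) K = orbit_map K (f D) K"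
    using orbit_map_self[OF K S D] orbit_map_self[OF K T fD] self_lcoset[OF K] by (simp add: compose_def)
qed

end

section \<open>Modules of equivariant functions\<close>

text \<open>
  For \<open>S = G/H\<close>, a finite \<open>G\<close>-set \<open>X\<close> and an invariant \<open>Q\<close>, evaluation at the coset \<open>H\<close> identifies these functions with the \<open>\<int>\<close>-linear
  combinations of \<open>H\<close>-fixed elements of \<open>X\<close> that lie in \<open>Q\<close>; with \<open>Q = UNIV\<close> this is the free module
  \<open>\<int>[X\<^sup>H]\<close>.  Functions on \<open>S\<close> avoid choosing \<open>H\<close>, and restriction along a map of orbits becomes
  precomposition.
\<close>

definition eqv_fun :: "('g, 'm) monoid_scheme \<Rightarrow> 'x set \<Rightarrow> ('g \<Rightarrow> 'x \<Rightarrow> 'x) \<Rightarrow> ('x \<Rightarrow> int) set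
     \<Rightarrow> 'g set set \<Rightarrow> ('g set \<Rightarrow> 'x \<Rightarrow> int) set" where
  "eqv_fun G X act Q S =
     {v. (\<forall>C x. v C x \<noteq> 0 \<longrightarrow> C \<in> S \<and> x \<in> X \<and> (\<forall>g\<in>carrier G. g <#\<^bsub>G\<^esub> C = C \<longrightarrow> act g x = x)) \<and>
         (\<forall>g\<in>carrier G. \<forall>C\<in>S. \<forall>x\<in>X. v (g <#\<^bsub>G\<^esub> C) (act g x) = v C x) \<and>
         (\<forall>C\<in>S. v C \<in> Q)}"

definition eqv_module :: "('g, 'm) monoid_scheme \<Rightarrow> 'x set \<Rightarrow> ('g \<Rightarrow> 'x \<Rightarrow> 'x) \<Rightarrow> ('x \<Rightarrow> int) set
     \<Rightarrow> ('g, 'g set \<Rightarrow> 'x \<Rightarrow> int) orbit_module" where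
  "eqv_module G X act Q =
     \<lparr>mobj = (\<lambda>S. \<lparr>carrier = eqv_fun G X act Q S,
                   monoid.mult = (\<lambda>v w C x. v C x + w C x), one = (\<lambda>C x. 0)\<rparr>),
      mmap = (\<lambda>S T f v C x. if C \<in> S then v (f C) x else 0)\<rparr>"

lemma eqv_module_simps [simp]:
  "carrier (mobj (eqv_module G X act Q) S) = eqv_fun G X act Q S"
  "v \<otimes>\<^bsub>mobj (eqv_module G X act Q) S\<^esub> w = (\<lambda>C x. v C x + w C x)"
  "\<one>\<^bsub>mobj (eqv_module G X act Q) S\<^esub> = (\<lambda>C x. 0)"
  "mmap (eqv_module G X act Q) S T f v = (\<lambda>C x. if C \<in> S then v (f C) x else 0)"
  by (simp_all add: eqv_module_def)

lemma eqv_funD: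
  assumes "v \<in> eqv_fun G X act Q S"
  shows "v C x \<noteq> 0 \<Longrightarrow> C \<in> S" and "v C x \<noteq> 0 \<Longrightarrow> x \<in> X"
    and "\<lbrakk>v C x \<noteq> 0; g \<in> carrier G; g <#\<^bsub>G\<^esub> C = C\<rbrakk> \<Longrightarrow> act g x = x"
    and "\<lbrakk>g \<in> carrier G; C \<in> S; x \<in> X\<rbrakk> \<Longrightarrow> v (g <#\<^bsub>G\<^esub> C) (act g x) = v C x"
    and "C \<in> S \<Longrightarrow> v C \<in> Q"
  using assms by (simp_all add: eqv_fun_def)

lemma eqv_funI:
  assumes "\<And>C x. v C x \<noteq> 0 \<Longrightarrow> C \<in> S" and "\<And>C x. v C x \<noteq> 0 \<Longrightarrow> x \<in> X"
    and "\<And>C x g. \<lbrakk>v C x \<noteq> 0; g \<in> carrier G; g <#\<^bsub>G\<^esub> C = C\<rbrakk> \<Longrightarrow> act g x = x"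
    and "\<And>C x g. \<lbrakk>g \<in> carrier G; C \<in> S; x \<in> X\<rbrakk> \<Longrightarrow> v (g <#\<^bsub>G\<^esub> C) (act g x) = v C x"
    and "\<And>C. C \<in> S \<Longrightarrow> v C \<in> Q"
  shows "v \<in> eqv_fun G X act Q S"
  using assms by (simp add: eqv_fun_def)

lemma eqv_fun_add:
  assumes "v \<in> eqv_fun G X act Q S" "w \<in> eqv_fun G X act Q S"
    and "\<And>a b. a \<in> Q \<Longrightarrow> b \<in> Q \<Longrightarrow> (\<lambda>x. a x + b x) \<in> Q"
  shows "(\<lambda>C x. v C x + w C x) \<in> eqv_fun G X act Q S"
proof -
  note v = eqv_funD[OF assms(1)] and w = eqv_funD[OF assms(2)]
  have nz: "v C x \<noteq> 0 \<or> w C x \<noteq> 0" if "v C x + w C x \<noteq> 0" for C x using that by auto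
  show ?thesis
  proof (rule eqv_funI)
    show "C \<in> S" if "v C x + w C x \<noteq> 0" for C x using nz[OF that] v(1) w(1) by blast
    show "x \<in> X" if "v C x + w C x \<noteq> 0" for C x using nz[OF that] v(2) w(2) by blast
    show "act g x = x" if "v C x + w C x \<noteq> 0" "g \<in> carrier G" "g <#\<^bsub>G\<^esub> C = C" for C x g
      using nz[OF that(1)] v(3) w(3) that(2,3) by blast
    show "v (g <#\<^bsub>G\<^esub> C) (act g x) + w (g <#\<^bsub>G\<^esub> C) (act g x) = v C x + w C x"
      if "g \<in> carrier G" "C \<in> S" "x \<in> X" for C x g
      using v(4)[OF that] w(4)[OF that] by simp
    show "(\<lambda>x. v C x + w C x) \<in> Q" if "C \<in> S" for C using assms(3) v(5)[OF that] w(5)[OF that] .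
  qed
qed

context finite_group_family
begin

lemma is_orbit_module_eqv:
  assumes "(\<lambda>x. 0) \<in> Q" and add: "\<And>a b. a \<in> Q \<Longrightarrow> b \<in> Q \<Longrightarrow> (\<lambda>x. a x + b x) \<in> Q"
    and "\<And>a. a \<in> Q \<Longrightarrow> (\<lambda>x. - a x) \<in> Q"
  shows "is_orbit_module G F (eqv_module G X act Q)" (is "is_orbit_module G F ?M")
proof -
  have "comm_group (mobj ?M S)" if "S \<in> obj" for S
  proof (rule comm_groupI)
    fix v assume v: "v \<in> carrier (mobj ?M S)"
    then have v': "v \<in> eqv_fun G X act Q S" by simp
    have "(\<lambda>C x. - v C x) \<in> eqv_fun G X act Q S"
      by (rule eqv_funI) (use eqv_funD[OF v'] assms(3) in simp_all)
    then show "\<exists>w\<in>carrier (mobj ?M S). w \<otimes>\<^bsub>mobj ?M S\<^esub> v = \<one>\<^bsub>mobj ?M S\<^esub>"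
      by (intro bexI[of _ "\<lambda>C x. - v C x"]) simp_all
  next
    show "\<one>\<^bsub>mobj ?M S\<^esub> \<in> carrier (mobj ?M S)" using assms(1) by (simp add: eqv_fun_def)
  qed (simp_all add: eqv_fun_add add ac_simps)
  moreover have pull: "(\<lambda>C x. if C \<in> S then v (f C) x else 0) \<in> eqv_fun G X act Q S"
    if S: "S \<in> obj" and f: "f \<in> orbit_mor G S T" and v: "v \<in> eqv_fun G X act Q T" for S T f v
  proof (rule eqv_funI)
    fix C x g assume "(if C \<in> S then v (f C) x else 0) \<noteq> 0" and g: "g \<in> carrier G" "g <# C = C"
    then have C: "C \<in> S" "v (f C) x \<noteq> 0" by (auto split: if_splits)
    moreover have "g <# f C = f C" using orbit_morD(2)[OF f g(1) C(1)] g(2) by simp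
    ultimately show "act g x = x" using eqv_funD(3)[OF v] g(1) by blast
  next
    fix C x g assume "g \<in> carrier G" "C \<in> S" "x \<in> X"
    then show "(if g <# C \<in> S then v (f (g <# C)) (act g x) else 0) = (if C \<in> S then v (f C) x else 0)"
      using obj_act[OF S, of C g] orbit_morD(1)[OF f, of C] orbit_morD(2)[OF f, of g C]
        eqv_funD(4)[OF v, of g "f C" x] by simp
  next
    fix C assume "C \<in> S"
    then show "(\<lambda>x. if C \<in> S then v (f C) x else 0) \<in> Q"
      using eqv_funD(5)[OF v orbit_morD(1)[OF f]] by simp
  qed (use eqv_funD(2)[OF v] in \<open>simp_all split: if_splits\<close>)
  moreover have "(\<lambda>C x. if C \<in> S then v (restrict id S C) x else 0) = v"
    if v: "v \<in> eqv_fun G X act Q S" for S v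
  proof (intro ext)
    fix C x
    show "(if C \<in> S then v (restrict id S C) x else 0) = v C x" using eqv_funD(1)[OF v, of C x] by auto
  qed
  ultimately show ?thesis
    unfolding is_orbit_module_def
    by (simp add: hom_def) (auto simp: fun_eq_iff compose_def dest: orbit_morD(1))
qed

text \<open>
  Such a function is determined by its finitely many values on \<open>S \<times> X\<close>.
\<close>

lemma countable_eqv_fun:
  assumes "S \<in> obj" "finite X"
  shows "countable (eqv_fun G X act Q S)"
proof -
  obtain ps where ps: "set ps = S \<times> X" using finite_list[of "S \<times> X"] finite_obj[OF assms(1)] assms(2) by blast
  have "inj_on (\<lambda>v. map (\<lambda>(C, x). v C x) ps) (eqv_fun G X act Q S)"
  proof (rule inj_onI, intro ext)
    fix v w C x
    assume v: "v \<in> eqv_fun G X act Q S" and w: "w \<in> eqv_fun G X act Q S"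
      and eq: "map (\<lambda>(C, x). v C x) ps = map (\<lambda>(C, x). w C x) ps"
    show "v C x = w C x"
    proof (cases "(C, x) \<in> S \<times> X")
      case True
      then show ?thesis using eq ps by auto
    next
      case False
      then have "v C x = 0" "w C x = 0"
        using eqv_funD(1,2)[OF v, of C x] eqv_funD(1,2)[OF w, of C x] by blast+
      then show ?thesis by simp
    qed
  qed
  then show ?thesis by (rule countableI')
qed

end

section \<open>The augmentation and the boundary map\<close>

text \<open>
  A union of orbits \<open>G/H\<close> with \<open>H \<in> F\<close>, large enough for the augmentation \<open>\<int>[X\<^sup>H] \<rightarrow> \<int>\<close> to be
  surjective for all \<open>H \<in> F\<close>.
\<close>

locale covering_gset = finite_group_family G F for G (structure) and F +
  fixes X :: "'a set set"
  assumes X_obj: "x \<in> X \<Longrightarrow> \<exists>T\<in>orbit_obj G F. x \<in> T"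
    and X_act: "\<lbrakk>x \<in> X; g \<in> carrier G\<rbrakk> \<Longrightarrow> g <# x \<in> X"
    and X_covers: "H \<in> F \<Longrightarrow> \<exists>x\<in>X. H \<subseteq> stab x"
begin

lemma X_subset: "x \<in> X \<Longrightarrow> x \<subseteq> carrier G"
  using X_obj obj_subset by blast

lemma finite_X: "finite X"
proof (rule finite_subset)
  show "X \<subseteq> Pow (carrier G)" using X_subset by blast
qed (simp add: finite_G)

lemma X_one: "x \<in> X \<Longrightarrow> \<one> <# x = x"
  using lcos_mult_one X_subset by blast

lemma X_mult: "\<lbrakk>x \<in> X; g \<in> carrier G; h \<in> carrier G\<rbrakk> \<Longrightarrow> (g \<otimes> h) <# x = g <# (h <# x)"
  using lcos_m_assoc[OF X_subset, of x g h] by simp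

lemma X_stab: "x \<in> X \<Longrightarrow> stab x \<in> F"
  using X_obj stab_obj by blast

lemma X_bij:
  assumes g: "g \<in> carrier G"
  shows "bij_betw (\<lambda>x. g <# x) X X"
proof (rule bij_betw_byWitness[where f' = "\<lambda>x. inv g <# x"])
  show "\<forall>x\<in>X. inv g <# (g <# x) = x" "\<forall>x\<in>X. g <# (inv g <# x) = x"
    using g by (auto simp: X_mult[symmetric] X_one)
qed (use g X_act in auto)

definition orb :: "'a set \<Rightarrow> 'a set set" where
  "orb x = {g <# x | g. g \<in> carrier G}"

lemma orb_eq:
  assumes "T \<in> obj" "x \<in> T"
  shows "orb x = T"
proof
  show "orb x \<subseteq> T" using obj_act[OF assms] by (auto simp: orb_def)
  show "T \<subseteq> orb x" using obj_transitive[OF assms] by (auto simp: orb_def)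
qed

lemma orb_obj: "x \<in> X \<Longrightarrow> orb x \<in> obj" and self_orb: "x \<in> X \<Longrightarrow> x \<in> orb x"
  using X_obj orb_eq by force+

lemma orb_subset: "x \<in> X \<Longrightarrow> orb x \<subseteq> X"
  using X_act by (auto simp: orb_def)

definition act2 :: "'a \<Rightarrow> 'a set \<times> 'a set \<Rightarrow> 'a set \<times> 'a set" where
  "act2 g = map_prod (\<lambda>x. g <# x) (\<lambda>x. g <# x)"

abbreviation vertex_chains :: "('a set \<Rightarrow> int) set \<Rightarrow> ('a, 'a set \<Rightarrow> 'a set \<Rightarrow> int) orbit_module" where
  "vertex_chains Q \<equiv> eqv_module G X (l_coset G) Q"

abbreviation vertex_fun :: "('a set \<Rightarrow> int) set \<Rightarrow> 'a set set \<Rightarrow> ('a set \<Rightarrow> 'a set \<Rightarrow> int) set" where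
  "vertex_fun Q \<equiv> eqv_fun G X (l_coset G) Q"

abbreviation edge_chains :: "('a, 'a set \<Rightarrow> 'a set \<times> 'a set \<Rightarrow> int) orbit_module" where
  "edge_chains \<equiv> eqv_module G (X \<times> X) act2 UNIV"

abbreviation edge_fun :: "'a set set \<Rightarrow> ('a set \<Rightarrow> 'a set \<times> 'a set \<Rightarrow> int) set" where
  "edge_fun \<equiv> eqv_fun G (X \<times> X) act2 UNIV"

definition cycles :: "('a set \<Rightarrow> int) set" where
  "cycles = {a. (\<Sum>x\<in>X. a x) = 0}"

text \<open>
  The sum of coefficients does not depend on the coset where it is taken, by \<open>aug_eq\<close>.
\<close>

definition aug :: "'a set set \<Rightarrow> ('a set \<Rightarrow> 'a set \<Rightarrow> int) \<Rightarrow> int" where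
  "aug S v = (\<Sum>x\<in>X. v (SOME C. C \<in> S) x)"

definition bd :: "'a set set \<Rightarrow> ('a set \<Rightarrow> 'a set \<times> 'a set \<Rightarrow> int) \<Rightarrow> 'a set \<Rightarrow> 'a set \<Rightarrow> int" where
  "bd S v = (\<lambda>C w. (\<Sum>u\<in>X. v C (u, w)) - (\<Sum>u\<in>X. v C (w, u)))"

lemma obj_nonempty: "S \<in> obj \<Longrightarrow> (SOME C. C \<in> S) \<in> S"
  by (elim objE) (metis self_lcoset someI)

lemma aug_eq:
  assumes S: "S \<in> obj" and v: "v \<in> vertex_fun Q S" and C: "C \<in> S"
  shows "(\<Sum>x\<in>X. v C x) = aug S v"
proof -
  obtain g where g: "g \<in> carrier G" "(SOME C. C \<in> S) = g <# C"
    using obj_transitive[OF S C obj_nonempty[OF S]] by blast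
  have "aug S v = (\<Sum>x\<in>X. v (g <# C) (g <# x))"
    unfolding aug_def g(2) by (rule sum.reindex_bij_betw[OF X_bij[OF g(1)], symmetric])
  also have "\<dots> = (\<Sum>x\<in>X. v C x)"
    using eqv_funD(4)[OF v g(1) C] by simp
  finally show ?thesis by simp
qed

lemma vertex_chains_module: "is_orbit_module G F (vertex_chains UNIV)"
  by (rule is_orbit_module_eqv) simp_all

lemma cycles_orbit_module: "is_orbit_module G F (vertex_chains cycles)"
  by (rule is_orbit_module_eqv) (simp_all add: cycles_def sum.distrib sum_negf)

lemma edge_chains_module: "is_orbit_module G F edge_chains"
  by (rule is_orbit_module_eqv) simp_all

lemma const_int_orbit_module: "is_orbit_module G F const_int_module"
  unfolding is_orbit_module_def const_int_module_def
  by (auto simp: hom_def intro!: group.group_comm_groupI)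

lemma aug_hom: "aug \<in> orbit_module_hom G F (vertex_chains UNIV) const_int_module"
  unfolding orbit_module_hom_def mem_Collect_eq
proof (intro conjI ballI)
  fix S assume "S \<in> obj"
  show "aug S \<in> hom (mobj (vertex_chains UNIV) S) (mobj const_int_module S)"
    by (simp add: hom_def const_int_module_def aug_def sum.distrib)
next
  fix S T f v
  assume S: "S \<in> obj" and T: "T \<in> obj" and f: "f \<in> orbit_mor G S T" and "v \<in> carrier (mobj (vertex_chains UNIV) T)"
  then have v: "v \<in> vertex_fun UNIV T" by simp
  let ?C = "SOME C. C \<in> S"
  have "aug S (mmap (vertex_chains UNIV) S T f v) = (\<Sum>x\<in>X. v (f ?C) x)"
    using obj_nonempty[OF S] by (simp add: aug_def)
  also have "\<dots> = aug T v"
    by (rule aug_eq[OF T v orbit_morD(1)[OF f obj_nonempty[OF S]]])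
  finally show "aug S (mmap (vertex_chains UNIV) S T f v) = mmap const_int_module S T f (aug T v)"
    by (simp add: const_int_module_def)
qed

text \<open>
  An equivariant map \<open>b : S \<rightarrow> X\<close>.  It provides the preimages for both surjectivity statements: the
  vertex \<open>b C\<close> has augmentation one, and every vertex of a cycle is joined to \<open>b C\<close> by an edge.
\<close>

lemma base_point:
  assumes "S \<in> obj"
  obtains b where "\<And>C. C \<in> S \<Longrightarrow> b C \<in> X" and "\<And>C g. \<lbrakk>C \<in> S; g \<in> carrier G\<rbrakk> \<Longrightarrow> b (g <# C) = g <# b C"
proof -
  obtain H where H: "H \<in> F" "S = lcosets H" using assms by (rule objE)
  obtain x where x: "x \<in> X" "H \<subseteq> stab x" using X_covers[OF H(1)] by blast
  note b = orbit_map_mor[OF H(1) orb_obj[OF x(1)] self_orb[OF x(1)] x(2)]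
  show thesis
  proof (rule that[of "orbit_map H x"])
    show "orbit_map H x C \<in> X" if "C \<in> S" for C
      using orbit_morD(1)[OF b] that H(2) orb_subset[OF x(1)] by blast
    show "orbit_map H x (g <# C) = g <# orbit_map H x C" if "C \<in> S" "g \<in> carrier G" for C g
      using orbit_morD(2)[OF b that(2)] that(1) H(2) by simp
  qed
qed

lemma aug_surj: "orbit_module_surj G F (vertex_chains UNIV) const_int_module aug"
  unfolding orbit_module_surj_def
proof
  fix S assume S: "S \<in> obj"
  obtain b where b: "\<And>C. C \<in> S \<Longrightarrow> b C \<in> X" "\<And>C g. \<lbrakk>C \<in> S; g \<in> carrier G\<rbrakk> \<Longrightarrow> b (g <# C) = g <# b C"
    using base_point[OF S] by blast
  have "n \<in> aug S ` carrier (mobj (vertex_chains UNIV) S)" for n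
  proof
    define v where "v = (\<lambda>C x. if C \<in> S \<and> x = b C then n else 0)"
    have "v \<in> vertex_fun UNIV S"
    proof (rule eqv_funI)
      fix C x g assume g: "g \<in> carrier G" "C \<in> S" "x \<in> X"
      have "g <# x = g <# b C \<longleftrightarrow> x = b C"
        using X_bij[OF g(1)] g(3) b(1)[OF g(2)] by (auto simp: bij_betw_def inj_on_eq_iff)
      then show "v (g <# C) (g <# x) = v C x"
        using g b(2)[OF g(2,1)] obj_act[OF S g(2,1)] by (simp add: v_def)
    next
      fix C x g assume "v C x \<noteq> 0" "g \<in> carrier G" "g <# C = C"
      then show "g <# x = x" using b(2)[of C g] by (auto simp: v_def split: if_splits)
    qed (use b(1) in \<open>auto simp: v_def split: if_splits\<close>)
    then show "v \<in> carrier (mobj (vertex_chains UNIV) S)" by simp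
    have "aug S v = (\<Sum>x\<in>X. if x = b (SOME C. C \<in> S) then n else 0)"
      using obj_nonempty[OF S] by (simp add: aug_def v_def)
    then show "n = aug S v" using finite_X b(1)[OF obj_nonempty[OF S]] by simp
  qed
  then show "aug S ` carrier (mobj (vertex_chains UNIV) S) = carrier (mobj const_int_module S)"
    by (auto simp: const_int_module_def)
qed

lemma bd_closed:
  assumes S: "S \<in> obj" and v: "v \<in> edge_fun S"
  shows "bd S v \<in> vertex_fun cycles S"
proof (rule eqv_funI)
  have nz: "\<exists>u. v C (u, w) \<noteq> 0 \<or> v C (w, u) \<noteq> 0" if "bd S v C w \<noteq> 0" for C w
  proof (rule ccontr)
    assume "\<not> ?thesis"
    then show False using that by (simp add: bd_def)
  qed
  show "C \<in> S" if "bd S v C w \<noteq> 0" for C w using nz[OF that] eqv_funD(1)[OF v] by blast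
  show "w \<in> X" if "bd S v C w \<noteq> 0" for C w
    using nz[OF that] eqv_funD(2)[OF v, of C "(_, _)"] by blast
  show "g <# w = w" if w: "bd S v C w \<noteq> 0" and g: "g \<in> carrier G" "g <# C = C" for C w g
  proof -
    obtain u where "v C (u, w) \<noteq> 0 \<or> v C (w, u) \<noteq> 0" using nz[OF w] by blast
    then show ?thesis
      using eqv_funD(3)[OF v _ g, of "(u, w)"] eqv_funD(3)[OF v _ g, of "(w, u)"]
      by (auto simp: act2_def)
  qed
  show "bd S v (g <# C) (g <# w) = bd S v C w" if g: "g \<in> carrier G" and C: "C \<in> S" and w: "w \<in> X" for C w g
  proof -
    have "(\<Sum>u\<in>X. v (g <# C) (u, g <# w)) = (\<Sum>u\<in>X. v (g <# C) (g <# u, g <# w))"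
      by (rule sum.reindex_bij_betw[OF X_bij[OF g], symmetric])
    moreover have "(\<Sum>u\<in>X. v (g <# C) (g <# w, u)) = (\<Sum>u\<in>X. v (g <# C) (g <# w, g <# u))"
      by (rule sum.reindex_bij_betw[OF X_bij[OF g], symmetric])
    ultimately show ?thesis
      using eqv_funD(4)[OF v g C, of "(_, w)"] eqv_funD(4)[OF v g C, of "(w, _)"] w
      by (simp add: bd_def act2_def)
  qed
  show "bd S v C \<in> cycles" for C
    using sum.swap[of "\<lambda>w u. v C (u, w)" X X] by (simp add: cycles_def bd_def sum_subtractf)
qed

lemma bd_hom: "bd \<in> orbit_module_hom G F edge_chains (vertex_chains cycles)"
  unfolding orbit_module_hom_def mem_Collect_eq
proof (intro conjI ballI)
  fix S assume S: "S \<in> obj"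
  show "bd S \<in> hom (mobj edge_chains S) (mobj (vertex_chains cycles) S)"
    using bd_closed[OF S] by (auto simp: hom_def) (simp add: bd_def sum.distrib fun_eq_iff)
next
  fix S T f v
  show "bd S (mmap edge_chains S T f v) = mmap (vertex_chains cycles) S T f (bd T v)"
    by (simp add: bd_def fun_eq_iff)
qed

lemma bd_surj: "orbit_module_surj G F edge_chains (vertex_chains cycles) bd"
  unfolding orbit_module_surj_def
proof
  fix S assume S: "S \<in> obj"
  obtain b where b: "\<And>C. C \<in> S \<Longrightarrow> b C \<in> X" "\<And>C g. \<lbrakk>C \<in> S; g \<in> carrier G\<rbrakk> \<Longrightarrow> b (g <# C) = g <# b C"
    using base_point[OF S] by blast
  have "w \<in> bd S ` carrier (mobj edge_chains S)" if w: "w \<in> vertex_fun cycles S" for w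
  proof
    define v where "v = (\<lambda>C (y, z). if C \<in> S \<and> y = b C then w C z else 0)"
    have "v \<in> edge_fun S"
    proof (rule eqv_funI)
      fix C e assume "v C e \<noteq> 0"
      then show "C \<in> S" "e \<in> X \<times> X"
        using b(1) eqv_funD(2)[OF w] by (auto simp: v_def split: if_splits prod.splits)
    next
      fix C e g assume "v C e \<noteq> 0" and g: "g \<in> carrier G" "g <# C = C"
      then obtain z where "C \<in> S" "e = (b C, z)" "w C z \<noteq> 0"
        by (auto simp: v_def split: if_splits prod.splits)
      then show "act2 g e = e" using b(2)[of C g] g eqv_funD(3)[OF w] by (simp add: act2_def)
    next
      fix C e g assume g: "g \<in> carrier G" "C \<in> S" "e \<in> X \<times> X"
      then obtain y z where e: "e = (y, z)" "y \<in> X" "z \<in> X" by blast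
      have "g <# y = g <# b C \<longleftrightarrow> y = b C"
        using X_bij[OF g(1)] e(2) b(1)[OF g(2)] by (auto simp: bij_betw_def inj_on_eq_iff)
      then show "v (g <# C) (act2 g e) = v C e"
        using g e b(2)[OF g(2,1)] obj_act[OF S g(2,1)] eqv_funD(4)[OF w g(1,2)]
        by (simp add: v_def act2_def)
    qed simp
    then show "v \<in> carrier (mobj edge_chains S)" by simp
    show "w = bd S v"
    proof (intro ext)
      fix C z
      show "w C z = bd S v C z"
      proof (cases "C \<in> S")
        case True
        have "(\<Sum>u\<in>X. v C (z, u)) = (if z = b C then \<Sum>u\<in>X. w C u else 0)"
          using True by (simp add: v_def)
        moreover have "(\<Sum>u\<in>X. w C u) = 0" using eqv_funD(5)[OF w True] by (simp add: cycles_def)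
        moreover have "(\<Sum>u\<in>X. v C (u, z)) = (\<Sum>u\<in>X. if u = b C then w C z else 0)"
          using True by (simp add: v_def)
        ultimately show ?thesis using True b(1) finite_X by (simp add: bd_def)
      next
        case False
        then show ?thesis using eqv_funD(1)[OF w, of C z] by (auto simp: bd_def v_def)
      qed
    qed
  qed
  then show "bd S ` carrier (mobj edge_chains S) = carrier (mobj (vertex_chains cycles) S)"
    using bd_closed[OF S] by auto
qed

end

section \<open>From a short resolution to a bicombing\<close>

context finite_group_family
begin

abbreviation free_orbit :: "'a set set" where
  "free_orbit \<equiv> lcosets {\<one>}"

lemma trivial_subset_stab_obj: "S \<in> obj \<Longrightarrow> D \<in> S \<Longrightarrow> {\<one>} \<subseteq> stab D"
  using act_one_lcos by (simp add: stab_def)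

lemma subgroup_subset_stab_self:
  assumes "subgroup L G"
  shows "L \<subseteq> stab L"
proof
  fix g assume "g \<in> L"
  then show "g \<in> stab L" using assms by (simp add: stab_def coset_join3 subgroup.mem_carrier)
qed

text \<open>
  By naturality, values at \<open>G/1\<close> of elements pulled back from \<open>G/L\<close> can be read off at \<open>G/L\<close>.  With
  \<open>D = L\<close> this yields the support statement below, and with \<open>L = 1\<close>, \<open>D = g\<close> the equivariance.
\<close>

lemma hom_to_eqv_pullback:
  assumes \<eta>: "\<eta> \<in> orbit_module_hom G F P (eqv_module G Y actY Q)"
    and L: "L \<in> F" and D: "D \<in> lcosets L" and p: "p \<in> carrier (mobj P (lcosets L))"
  shows "\<eta> free_orbit (mmap P free_orbit (lcosets L) (orbit_map {\<one>} D) p) {\<one>} e = \<eta> (lcosets L) p D e"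
proof -
  note T = trivial_in_family
  note D1 = D trivial_subset_stab_obj[OF lcosets_obj[OF L] D]
  show ?thesis
    using orbit_module_homD(2)[OF \<eta> lcosets_obj[OF T] lcosets_obj[OF L]
        orbit_map_mor[OF T lcosets_obj[OF L] D1] p]
    by (simp add: self_lcoset[OF T] orbit_map_self[OF T lcosets_obj[OF L] D1])
qed

lemma hom_to_eqv_support:
  assumes \<eta>: "\<eta> \<in> orbit_module_hom G F P (eqv_module G Y actY Q)"
    and L: "L \<in> F" and p: "p \<in> carrier (mobj P (lcosets L))"
    and nz: "\<eta> free_orbit (mmap P free_orbit (lcosets L) (orbit_map {\<one>} L) p) {\<one>} e \<noteq> 0"
    and g: "g \<in> L"
  shows "actY g e = e"
proof -
  have "\<eta> (lcosets L) p \<in> eqv_fun G Y actY Q (lcosets L)"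
    using hom_in_carrier[OF orbit_module_homD(1)[OF \<eta> lcosets_obj[OF L]] p] by simp
  moreover have "\<eta> (lcosets L) p L e \<noteq> 0"
    using nz hom_to_eqv_pullback[OF \<eta> L self_lcoset[OF L] p] by simp
  moreover have "g \<in> carrier G" "g <# L = L"
    using subgroup_subset_stab_self[OF family_subgroup[OF L]] g by (auto simp: stab_def)
  ultimately show ?thesis by (rule eqv_funD(3))
qed

lemma hom_to_eqv_equivariant:
  assumes \<eta>: "\<eta> \<in> orbit_module_hom G F P (eqv_module G Y actY Q)"
    and p: "p \<in> carrier (mobj P free_orbit)" and g: "g \<in> carrier G" and e: "e \<in> Y"
  shows "\<eta> free_orbit (mmap P free_orbit free_orbit (orbit_map {\<one>} (g <# {\<one>})) p) {\<one>} (actY g e)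
           = \<eta> free_orbit p {\<one>} e"
proof -
  note T = trivial_in_family
  have "\<eta> free_orbit p \<in> eqv_fun G Y actY Q free_orbit"
    using hom_in_carrier[OF orbit_module_homD(1)[OF \<eta> lcosets_obj[OF T]] p] by simp
  from eqv_funD(4)[OF this g self_lcoset[OF T] e] show ?thesis
    using hom_to_eqv_pullback[OF \<eta> T lcosetsI[OF g] p] by simp
qed

end

context covering_gset
begin

definition act :: "'a \<Rightarrow> 'a set \<Rightarrow> 'a set" where
  "act g = (\<lambda>x\<in>X. g <# x)"

lemma act_group_action: "group_action G X act"
proof -
  have Bij: "act g \<in> Bij X" if "g \<in> carrier G" for g
    using X_bij[OF that] by (simp add: Bij_def act_def)
  have "act (g \<otimes> h) = compose X (act g) (act h)" if "g \<in> carrier G" "h \<in> carrier G" for g h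
    using that X_mult X_act by (auto simp: act_def compose_def fun_eq_iff)
  then have "act \<in> hom G (BijGroup X)"
    using Bij by (simp add: hom_def BijGroup_def)
  then show ?thesis
    by (intro group_action.intro group_hom.intro group_hom_axioms.intro group_axioms group_BijGroup)
qed

lemma trivial_subset_stab: "x \<in> X \<Longrightarrow> {\<one>} \<subseteq> stab x"
  using X_one by (simp add: stab_def)

context
  fixes P0 P1 :: "('a, 'u::infinite) orbit_module"
    and d :: "'a set set \<Rightarrow> 'u \<Rightarrow> 'u" and \<epsilon> :: "'a set set \<Rightarrow> 'u \<Rightarrow> int"
  assumes P0: "projective_orbit_module G F P0" and P1: "projective_orbit_module G F P1"
    and d: "d \<in> orbit_module_hom G F P1 P0" and \<epsilon>: "\<epsilon> \<in> orbit_module_hom G F P0 const_int_module"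
    and \<epsilon>_surj: "orbit_module_surj G F P0 const_int_module \<epsilon>"
    and exact: "orbit_module_exact G F P1 P0 const_int_module d \<epsilon>"
    and d_inj: "\<And>S. S \<in> orbit_obj G F \<Longrightarrow> inj_on (d S) (carrier (mobj P1 S))"
begin

lemma resolution_modules: "is_orbit_module G F P0" "is_orbit_module G F P1"
  using P0 P1 by (auto simp: projective_orbit_module_def)

text \<open>
  One element of augmentation one for each orbit suffices: all others that are needed are its
  pullbacks, which makes them compatible.
\<close>

definition gen :: "'a set set \<Rightarrow> 'u" where
  "gen T = (SOME p. p \<in> carrier (mobj P0 T) \<and> \<epsilon> T p = 1)"

lemma gen:
  assumes "T \<in> obj"
  shows "gen T \<in> carrier (mobj P0 T)" and "\<epsilon> T (gen T) = 1"
proof -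
  have "1 \<in> \<epsilon> T ` carrier (mobj P0 T)"
    using \<epsilon>_surj assms by (simp add: orbit_module_surj_def const_int_module_def)
  then have "\<exists>p. p \<in> carrier (mobj P0 T) \<and> \<epsilon> T p = 1" by auto
  from someI_ex[OF this] show "gen T \<in> carrier (mobj P0 T)" "\<epsilon> T (gen T) = 1"
    by (simp_all add: gen_def)
qed

text \<open>
  The element over \<open>G/L\<close> corresponding to the \<open>L\<close>-fixed point \<open>x\<close>.
\<close>

definition vertex :: "'a set \<Rightarrow> 'a set \<Rightarrow> 'u" where
  "vertex L x = mmap P0 (lcosets L) (orb x) (orbit_map L x) (gen (orb x))"

context
  fixes L x assumes L: "L \<in> F" and x: "x \<in> X" "L \<subseteq> stab x"
begin

lemma vertex_mor: "orbit_map L x \<in> orbit_mor G (lcosets L) (orb x)"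
  by (rule orbit_map_mor[OF L orb_obj[OF x(1)] self_orb[OF x(1)] x(2)])

lemma vertex_closed: "vertex L x \<in> carrier (mobj P0 (lcosets L))"
  unfolding vertex_def
  by (rule hom_in_carrier[OF is_orbit_moduleD(2)[OF resolution_modules(1) lcosets_obj[OF L] orb_obj[OF x(1)] vertex_mor]
        gen(1)[OF orb_obj[OF x(1)]]])

lemma vertex_aug: "\<epsilon> (lcosets L) (vertex L x) = 1"
  unfolding vertex_def
  using orbit_module_homD(2)[OF \<epsilon> lcosets_obj[OF L] orb_obj[OF x(1)] vertex_mor gen(1)[OF orb_obj[OF x(1)]]]
    gen(2)[OF orb_obj[OF x(1)]]
  by (simp add: const_int_module_def)

lemma orbit_map_in_X:
  assumes "D \<in> lcosets L"
  shows "orbit_map L x D \<in> X"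
  using orbit_morD(1)[OF vertex_mor assms] orb_subset[OF x(1)] by blast

lemma vertex_pullback:
  assumes K: "K \<in> F" and D: "D \<in> lcosets L" "K \<subseteq> stab D"
  shows "mmap P0 (lcosets K) (lcosets L) (orbit_map K D) (vertex L x) = vertex K (orbit_map L x D)"
proof -
  have orb: "orb (orbit_map L x D) = orb x"
    by (rule orb_eq[OF orb_obj[OF x(1)] orbit_morD(1)[OF vertex_mor D(1)]])
  have "mmap P0 (lcosets K) (lcosets L) (orbit_map K D) (vertex L x)
      = mmap P0 (lcosets K) (orb x) (compose (lcosets K) (orbit_map L x) (orbit_map K D)) (gen (orb x))"
    unfolding vertex_def
    by (rule is_orbit_moduleD(4)[OF resolution_modules(1) lcosets_obj[OF K] lcosets_obj[OF L] orb_obj[OF x(1)]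
          orbit_map_mor[OF K lcosets_obj[OF L] D] vertex_mor gen(1)[OF orb_obj[OF x(1)]], symmetric])
  also have "\<dots> = vertex K (orbit_map L x D)"
    unfolding vertex_def orb
    using compose_orbit_map[OF K lcosets_obj[OF L] orb_obj[OF x(1)] vertex_mor D] by simp
  finally show ?thesis .
qed

end

text \<open>
  The element of \<open>P1\<close> over \<open>G/L\<close> with boundary \<open>y - x\<close>.  It exists by exactness and is unique because
  \<open>d\<close> is injective; uniqueness turns every compatibility of the points into one of the paths.
\<close>

definition path :: "'a set \<Rightarrow> 'a set \<Rightarrow> 'a set \<Rightarrow> 'u" where
  "path L x y = (SOME q. q \<in> carrier (mobj P1 (lcosets L)) \<and>
      d (lcosets L) q \<otimes>\<^bsub>mobj P0 (lcosets L)\<^esub> vertex L x = vertex L y)"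

lemma path:
  assumes L: "L \<in> F" and x: "x \<in> X" "L \<subseteq> stab x" and y: "y \<in> X" "L \<subseteq> stab y"
  shows "path L x y \<in> carrier (mobj P1 (lcosets L))"
    and "d (lcosets L) (path L x y) \<otimes>\<^bsub>mobj P0 (lcosets L)\<^esub> vertex L x = vertex L y"
proof -
  let ?S = "lcosets L"
  have S: "?S \<in> obj" by (rule lcosets_obj[OF L])
  interpret A: comm_group "mobj P0 ?S" by (rule is_orbit_moduleD(1)[OF resolution_modules(1) S])
  interpret \<epsilon>: group_hom "mobj P0 ?S" integer_group "\<epsilon> ?S"
    using orbit_module_homD(1)[OF \<epsilon> S]
    by (simp add: group_hom_def group_hom_axioms_def A.is_group const_int_module_def)
  note vx = vertex_closed[OF L x] and vy = vertex_closed[OF L y]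
  let ?a = "vertex L y \<otimes>\<^bsub>mobj P0 ?S\<^esub> inv\<^bsub>mobj P0 ?S\<^esub> vertex L x"
  have "\<epsilon> ?S (inv\<^bsub>mobj P0 ?S\<^esub> vertex L x) + \<epsilon> ?S (vertex L x) = 0"
    using \<epsilon>.hom_mult[of "inv\<^bsub>mobj P0 ?S\<^esub> vertex L x" "vertex L x"] vx \<epsilon>.hom_one by simp
  then have "\<epsilon> ?S ?a = 0"
    using \<epsilon>.hom_mult[OF vy A.inv_closed[OF vx]] vertex_aug[OF L x] vertex_aug[OF L y] by simp
  then have "?a \<in> kernel (mobj P0 ?S) (mobj const_int_module ?S) (\<epsilon> ?S)"
    using vx vy by (simp add: kernel_def const_int_module_def)
  also have "\<dots> = d ?S ` carrier (mobj P1 ?S)"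
    using exact S by (simp add: orbit_module_exact_def)
  finally obtain q where q: "q \<in> carrier (mobj P1 ?S)" "d ?S q = ?a" by auto
  have "?a \<otimes>\<^bsub>mobj P0 ?S\<^esub> vertex L x = vertex L y" using vx vy by (simp add: A.m_assoc)
  then have "\<exists>q. q \<in> carrier (mobj P1 ?S) \<and> d ?S q \<otimes>\<^bsub>mobj P0 ?S\<^esub> vertex L x = vertex L y" using q by auto
  from someI_ex[OF this]
  show "path L x y \<in> carrier (mobj P1 ?S)" "d ?S (path L x y) \<otimes>\<^bsub>mobj P0 ?S\<^esub> vertex L x = vertex L y"
    by (simp_all add: path_def)
qed

lemma path_unique:
  assumes L: "L \<in> F" and x: "x \<in> X" "L \<subseteq> stab x" and y: "y \<in> X" "L \<subseteq> stab y"
    and q: "q \<in> carrier (mobj P1 (lcosets L))"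
      "d (lcosets L) q \<otimes>\<^bsub>mobj P0 (lcosets L)\<^esub> vertex L x = vertex L y"
  shows "q = path L x y"
proof -
  let ?S = "lcosets L"
  have S: "?S \<in> obj" by (rule lcosets_obj[OF L])
  interpret A: comm_group "mobj P0 ?S" by (rule is_orbit_moduleD(1)[OF resolution_modules(1) S])
  note p = path[OF L x y] and dS = hom_in_carrier[OF orbit_module_homD(1)[OF d S]]
  have "d ?S q = d ?S (path L x y)"
    using q(2) p(2) A.right_cancel[OF vertex_closed[OF L x] dS[OF q(1)] dS[OF p(1)]] by simp
  then show ?thesis using inj_onD[OF d_inj[OF S] _ q(1) p(1)] by blast
qed

lemma path_pullback:
  assumes L: "L \<in> F" and x: "x \<in> X" "L \<subseteq> stab x" and y: "y \<in> X" "L \<subseteq> stab y"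
    and K: "K \<in> F" and D: "D \<in> lcosets L" "K \<subseteq> stab D"
  shows "mmap P1 (lcosets K) (lcosets L) (orbit_map K D) (path L x y)
           = path K (orbit_map L x D) (orbit_map L y D)"
proof (rule path_unique[OF K])
  let ?S = "lcosets L" and ?R = "lcosets K"
  have S: "?S \<in> obj" and R: "?R \<in> obj" by (simp_all add: lcosets_obj L K)
  note f = orbit_map_mor[OF K S D]
  show "orbit_map L x D \<in> X" "orbit_map L y D \<in> X"
    by (rule orbit_map_in_X[OF L x D(1)], rule orbit_map_in_X[OF L y D(1)])
  show "K \<subseteq> stab (orbit_map L x D)" "K \<subseteq> stab (orbit_map L y D)"
    using D orbit_mor_stab[OF vertex_mor[OF L x] D(1)] orbit_mor_stab[OF vertex_mor[OF L y] D(1)] by auto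
  note p = path[OF L x y]
  show "mmap P1 ?R ?S (orbit_map K D) (path L x y) \<in> carrier (mobj P1 ?R)"
    by (rule hom_in_carrier[OF is_orbit_moduleD(2)[OF resolution_modules(2) R S f] p(1)])
  have dp: "d ?S (path L x y) \<in> carrier (mobj P0 ?S)"
    by (rule hom_in_carrier[OF orbit_module_homD(1)[OF d S] p(1)])
  have "d ?R (mmap P1 ?R ?S (orbit_map K D) (path L x y)) \<otimes>\<^bsub>mobj P0 ?R\<^esub> vertex K (orbit_map L x D)
      = mmap P0 ?R ?S (orbit_map K D) (d ?S (path L x y)) \<otimes>\<^bsub>mobj P0 ?R\<^esub>
        mmap P0 ?R ?S (orbit_map K D) (vertex L x)"
    using orbit_module_homD(2)[OF d R S f p(1)] vertex_pullback[OF L x K D] by simp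
  also have "\<dots> = mmap P0 ?R ?S (orbit_map K D) (vertex L y)"
    using hom_mult[OF is_orbit_moduleD(2)[OF resolution_modules(1) R S f] dp vertex_closed[OF L x]] p(2) by simp
  finally show "d ?R (mmap P1 ?R ?S (orbit_map K D) (path L x y)) \<otimes>\<^bsub>mobj P0 ?R\<^esub> vertex K (orbit_map L x D)
      = vertex K (orbit_map L y D)"
    using vertex_pullback[OF L y K D] by simp
qed

lemma path_add:
  assumes L: "L \<in> F" and x: "x \<in> X" "L \<subseteq> stab x" and y: "y \<in> X" "L \<subseteq> stab y"
    and z: "z \<in> X" "L \<subseteq> stab z"
  shows "path L x z = path L x y \<otimes>\<^bsub>mobj P1 (lcosets L)\<^esub> path L y z"
proof -
  let ?S = "lcosets L"
  have S: "?S \<in> obj" by (rule lcosets_obj[OF L])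
  interpret A: comm_group "mobj P0 ?S" by (rule is_orbit_moduleD(1)[OF resolution_modules(1) S])
  interpret B: comm_group "mobj P1 ?S" by (rule is_orbit_moduleD(1)[OF resolution_modules(2) S])
  note p = path[OF L x y] and q = path[OF L y z] and h = orbit_module_homD(1)[OF d S]
  note vx = vertex_closed[OF L x]
  have "path L x y \<otimes>\<^bsub>mobj P1 ?S\<^esub> path L y z = path L x z"
  proof (rule path_unique[OF L x z])
    show "path L x y \<otimes>\<^bsub>mobj P1 ?S\<^esub> path L y z \<in> carrier (mobj P1 ?S)" using p(1) q(1) by simp
    have "d ?S (path L x y \<otimes>\<^bsub>mobj P1 ?S\<^esub> path L y z) \<otimes>\<^bsub>mobj P0 ?S\<^esub> vertex L x
       = d ?S (path L y z) \<otimes>\<^bsub>mobj P0 ?S\<^esub> (d ?S (path L x y) \<otimes>\<^bsub>mobj P0 ?S\<^esub> vertex L x)"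
      using hom_mult[OF h p(1) q(1)] hom_in_carrier[OF h p(1)] hom_in_carrier[OF h q(1)] vx
      by (simp add: A.m_ac)
    then show "d ?S (path L x y \<otimes>\<^bsub>mobj P1 ?S\<^esub> path L y z) \<otimes>\<^bsub>mobj P0 ?S\<^esub> vertex L x = vertex L z"
      using p(2) q(2) by simp
  qed
  then show ?thesis by simp
qed


text \<open>
  Lift \<open>\<epsilon>\<close> through the augmentation to \<open>a : P0 \<rightarrow> \<int>[X]\<close>, then lift \<open>a \<circ> d\<close>, which lands in the kernel
  of the augmentation, through the boundary map to \<open>\<alpha> : P1 \<rightarrow> \<int>[X \<times> X]\<close>.  Let \<open>c1 x y\<close> be the image of
  the path from \<open>x\<close> to \<open>y\<close>, and let \<open>A x\<close> be the image of the vertex \<open>x\<close>, which is a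
  combination of points fixed by the stabilizer of \<open>x\<close>.  The boundary of \<open>c1 x y\<close> is \<open>A y - A x\<close>.
  Adding the edges from the points of \<open>A y\<close> to \<open>y\<close> and subtracting those from the points of \<open>A x\<close> to
  \<open>x\<close> corrects it to \<open>y - x\<close>.
\<close>

lemma ex_bicombing: "\<exists>c. equivariant_bicombing G X act c"
proof -
  note T = trivial_in_family and Tob = lcosets_obj[OF trivial_in_family]
  let ?R = "free_orbit"
  have ctb: "countable (carrier (mobj (vertex_chains Q) S))" "countable (carrier (mobj edge_chains S))"
    if "S \<in> obj" for Q S
    using that by (simp_all add: countable_eqv_fun finite_X)
  obtain a where a: "a \<in> orbit_module_hom G F P0 (vertex_chains UNIV)"
    and aug_a: "\<And>S p. \<lbrakk>S \<in> obj; p \<in> carrier (mobj P0 S)\<rbrakk> \<Longrightarrow> aug S (a S p) = \<epsilon> S p"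
    using projective_lifting[OF P0 vertex_chains_module const_int_orbit_module ctb(1) _ aug_hom aug_surj \<epsilon>]
    by auto
  have ad: "(\<lambda>S q. a S (d S q)) \<in> orbit_module_hom G F P1 (vertex_chains UNIV)"
    by (rule orbit_module_hom_comp[OF resolution_modules(2) d a])
  have in_cycles: "a S (d S q) \<in> vertex_fun cycles S" if S: "S \<in> obj" and q: "q \<in> carrier (mobj P1 S)" for S q
  proof -
    have v: "a S (d S q) \<in> vertex_fun UNIV S"
      using hom_in_carrier[OF orbit_module_homD(1)[OF ad S] q] by simp
    have dq: "d S q \<in> carrier (mobj P0 S)" by (rule hom_in_carrier[OF orbit_module_homD(1)[OF d S] q])
    have "d S q \<in> kernel (mobj P0 S) (mobj const_int_module S) (\<epsilon> S)"
      using exact S q by (auto simp: orbit_module_exact_def)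
    then have "aug S (a S (d S q)) = 0"
      using aug_a[OF S dq] by (simp add: kernel_def const_int_module_def)
    then have "a S (d S q) C \<in> cycles" if "C \<in> S" for C
      using aug_eq[OF S v that] by (simp add: cycles_def)
    then show ?thesis using v by (simp add: eqv_fun_def)
  qed
  have "(\<lambda>S q. a S (d S q)) \<in> orbit_module_hom G F P1 (vertex_chains cycles)"
    using ad in_cycles by (auto simp: orbit_module_hom_def hom_def)
  then obtain \<alpha> where \<alpha>: "\<alpha> \<in> orbit_module_hom G F P1 edge_chains"
    and bd_\<alpha>: "\<And>S q. \<lbrakk>S \<in> obj; q \<in> carrier (mobj P1 S)\<rbrakk> \<Longrightarrow> bd S (\<alpha> S q) = a S (d S q)"
    using projective_lifting[OF P1 edge_chains_module cycles_orbit_module ctb(2) ctb(1) bd_hom bd_surj] by auto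
  define A where "A x z = a ?R (vertex {\<one>} x) {\<one>} z" for x z
  define c1 where "c1 x y e = \<alpha> ?R (path {\<one>} x y) {\<one>} e" for x y e
  define c where "c x y u v = c1 x y (u, v) + of_bool (v = y) * A y u - of_bool (v = x) * A x u" for x y u v
  note tr = trivial_subset_stab
  have move: "orbit_map {\<one>} x (g <# {\<one>}) = g <# x" if "x \<in> X" "g \<in> carrier G" for x g
    by (rule orbit_map_coset[OF T orb_obj[OF that(1)] self_orb[OF that(1)] tr[OF that(1)] that(2)])
  have stab_map: "orbit_map L x L = x" if "L \<in> F" "x \<in> X" "L \<subseteq> stab x" for L x
    by (rule orbit_map_self[OF that(1) orb_obj[OF that(2)] self_orb[OF that(2)] that(3)])
  have one_stab: "{\<one>} \<subseteq> stab L" if "L \<in> F" for L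
    by (rule trivial_subset_stab_obj[OF lcosets_obj[OF that] self_lcoset[OF that]])
  have A_act: "A (g <# x) (g <# z) = A x z" if g: "g \<in> carrier G" and x: "x \<in> X" and z: "z \<in> X" for g x z
    using hom_to_eqv_equivariant[OF a vertex_closed[OF T x tr[OF x]] g z]
      vertex_pullback[OF T x tr[OF x] T lcosetsI[OF g] trivial_subset_stab_obj[OF Tob lcosetsI[OF g]]]
      move[OF x g] by (simp add: A_def)
  have A_supp: "g <# z = z" if x: "x \<in> X" and nz: "A x z \<noteq> 0" and g: "g \<in> stab x" for g x z
  proof (rule hom_to_eqv_support[OF a X_stab[OF x] vertex_closed[OF X_stab[OF x] x order_refl] _ g])
    show "a ?R (mmap P0 ?R (lcosets stab x) (orbit_map {\<one>} (stab x)) (vertex (stab x) x)) {\<one>} z \<noteq> 0"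
      using vertex_pullback[OF X_stab[OF x] x order_refl T self_lcoset[OF X_stab[OF x]] one_stab[OF X_stab[OF x]]]
        stab_map[OF X_stab[OF x] x order_refl] nz by (simp add: A_def)
  qed
  have A_sum: "(\<Sum>z\<in>X. A x z) = 1" if x: "x \<in> X" for x
  proof -
    note vx = vertex_closed[OF T x tr[OF x]]
    have "a ?R (vertex {\<one>} x) \<in> vertex_fun UNIV ?R"
      using hom_in_carrier[OF orbit_module_homD(1)[OF a Tob] vx] by simp
    from aug_eq[OF Tob this self_lcoset[OF T]] show ?thesis
      using aug_a[OF Tob vx] vertex_aug[OF T x tr[OF x]] by (simp add: A_def)
  qed
  have c1_act: "c1 (g <# x) (g <# y) (g <# u, g <# v) = c1 x y (u, v)"
    if g: "g \<in> carrier G" and x: "x \<in> X" and y: "y \<in> X" and uv: "u \<in> X" "v \<in> X" for g x y u v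
  proof -
    have "(u, v) \<in> X \<times> X" using uv by simp
    from hom_to_eqv_equivariant[OF \<alpha> path(1)[OF T x tr[OF x] y tr[OF y]] g this] show ?thesis
      using path_pullback[OF T x tr[OF x] y tr[OF y] T lcosetsI[OF g] trivial_subset_stab_obj[OF Tob lcosetsI[OF g]]]
        move[OF x g] move[OF y g] by (simp add: c1_def act2_def)
  qed
  have c1_supp: "act2 g e = e"
    if x: "x \<in> X" and y: "y \<in> X" and nz: "c1 x y e \<noteq> 0" and g: "g \<in> stab x \<inter> stab y" for g x y e
  proof -
    let ?L = "stab x \<inter> stab y"
    have L: "?L \<in> F"
      by (rule family_down[OF X_stab[OF x]])
         (simp_all add: subgroups_Inter_pair family_subgroup X_stab x y)
    show ?thesis
    proof (rule hom_to_eqv_support[OF \<alpha> L path(1)[OF L x _ y] _ g])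
      show "\<alpha> ?R (mmap P1 ?R (lcosets ?L) (orbit_map {\<one>} ?L) (path ?L x y)) {\<one>} e \<noteq> 0"
        using path_pullback[OF L x _ y _ T self_lcoset[OF L] one_stab[OF L]]
          stab_map[OF L x] stab_map[OF L y] nz by (simp add: c1_def)
    qed simp_all
  qed
  have c1_add: "c1 x z e = c1 x y e + c1 y z e" if x: "x \<in> X" and y: "y \<in> X" and z: "z \<in> X" for x y z e
    using path_add[OF T x tr[OF x] y tr[OF y] z tr[OF z]]
      hom_mult[OF orbit_module_homD(1)[OF \<alpha> Tob] path(1)[OF T x tr[OF x] y tr[OF y]] path(1)[OF T y tr[OF y] z tr[OF z]]]
    by (simp add: c1_def)
  have c1_bd: "(\<Sum>u\<in>X. c1 x y (u, w)) - (\<Sum>u\<in>X. c1 x y (w, u)) = A y w - A x w"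
    if x: "x \<in> X" and y: "y \<in> X" for x y w
  proof -
    note p = path[OF T x tr[OF x] y tr[OF y]] and vx = vertex_closed[OF T x tr[OF x]]
    have "(\<Sum>u\<in>X. c1 x y (u, w)) - (\<Sum>u\<in>X. c1 x y (w, u)) = bd ?R (\<alpha> ?R (path {\<one>} x y)) {\<one>} w"
      by (simp add: bd_def c1_def)
    also have "\<dots> = a ?R (d ?R (path {\<one>} x y)) {\<one>} w" using bd_\<alpha>[OF Tob p(1)] by simp
    also have "\<dots> = A y w - A x w"
      using hom_mult[OF orbit_module_homD(1)[OF a Tob] hom_in_carrier[OF orbit_module_homD(1)[OF d Tob] p(1)] vx] p(2)
      by (simp add: A_def fun_eq_iff)
    finally show ?thesis .
  qed
  interpret act: group_action G X act by (rule act_group_action)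
  have "equivariant_bicombing G X act c"
  proof
    show "finite (carrier G)" "finite X" by (rule finite_G, rule finite_X)
  next
    fix x y z u v assume "x \<in> X" "y \<in> X" "z \<in> X"
    then show "c x z u v = c x y u v + c y z u v" using c1_add[of x y z "(u, v)"] by (simp add: c_def)
  next
    fix g x y u v assume g: "g \<in> carrier G" and X: "x \<in> X" "y \<in> X" "u \<in> X" "v \<in> X"
    have "g <# v = g <# y \<longleftrightarrow> v = y" "g <# v = g <# x \<longleftrightarrow> v = x"
      using X_bij[OF g] X by (auto simp: bij_betw_def inj_on_eq_iff)
    then show "c (act g x) (act g y) (act g u) (act g v) = c x y u v"
      using X c1_act[OF g X] A_act[OF g X(2,3)] A_act[OF g X(1,3)] by (simp add: c_def act_def)
  next
    fix x y w assume X: "x \<in> X" "y \<in> X" "w \<in> X"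
    have of_bool_sum: "(\<Sum>u\<in>X. of_bool (u = z) * A z w) = A z w" if "z \<in> X" for z
      using that finite_X by (simp add: of_bool_def flip: sum_distrib_right)
    have "(\<Sum>u\<in>X. c x y u w) - (\<Sum>u\<in>X. c x y w u)
      = ((\<Sum>u\<in>X. c1 x y (u, w)) - (\<Sum>u\<in>X. c1 x y (w, u)))
        + (of_bool (w = y) * (\<Sum>u\<in>X. A y u) - A y w) - (of_bool (w = x) * (\<Sum>u\<in>X. A x u) - A x w)"
      unfolding c_def sum.distrib sum_subtractf sum_distrib_left
      using of_bool_sum[OF X(1)] of_bool_sum[OF X(2)] by simp
    then show "(\<Sum>u\<in>X. c x y u w) - (\<Sum>u\<in>X. c x y w u) = of_bool (w = y) - of_bool (w = x)"
      using c1_bd[OF X(1,2)] A_sum X by simp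
  next
    fix x y u v g
    assume X: "x \<in> X" "y \<in> X" "u \<in> X" "v \<in> X" and nz: "c x y u v \<noteq> 0"
      and g: "g \<in> carrier G" "act g x = x" "act g y = y"
    then have gxy: "g \<in> stab x" "g \<in> stab y" by (auto simp: stab_def act_def)
    consider "c1 x y (u, v) \<noteq> 0" | "v = y" "A y u \<noteq> 0" | "v = x" "A x u \<noteq> 0"
    proof -
      have "c1 x y (u, v) \<noteq> 0 \<or> v = y \<and> A y u \<noteq> 0 \<or> v = x \<and> A x u \<noteq> 0"
      proof (rule ccontr)
        assume "\<not> ?thesis"
        then show False using nz by (cases "v = y"; cases "v = x"; simp add: c_def)
      qed
      then show thesis using that by blast
    qed
    then have "g <# u = u \<and> g <# v = v"
    proof cases
      case 1
      then show ?thesis using c1_supp[OF X(1,2) 1] gxy by (auto simp: act2_def)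
    next
      case 2
      then show ?thesis using A_supp[OF X(2) 2(2) gxy(2)] gxy(2) by (simp add: stab_def)
    next
      case 3
      then show ?thesis using A_supp[OF X(1) 3(2) gxy(1)] gxy(1) by (simp add: stab_def)
    qed
    then show "act g u = u \<and> act g v = v" using X by (simp add: act_def)
  qed
  then show ?thesis by blast
qed

end

end

section \<open>The lower bound\<close>

context covering_gset
begin

lemma stabilizer_act: "x \<in> X \<Longrightarrow> stabilizer G act x = stab x"
  by (simp add: stabilizer_def stab_def act_def)

lemma orbit_act: "x \<in> X \<Longrightarrow> orbit G act x = orb x"
  by (simp add: orbit_def orb_def act_def)

text \<open>
  In a covering set with as few points as possible, no orbit can be dropped.  If the stabilizer of \<open>x\<close>
  is contained in that of \<open>y\<close>, then every subgroup fixing a point \<open>g x\<close> also fixes \<open>g y\<close>, so \<open>y\<close> is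
  in the orbit of \<open>x\<close>.
\<close>

theorem carrier_in_family:
  assumes bicombing: "equivariant_bicombing G X act c"
    and minimal: "\<And>Y. \<lbrakk>Y \<subseteq> X; covering_gset G F Y\<rbrakk> \<Longrightarrow> card X \<le> card Y"
  shows "carrier G \<in> F"
proof -
  interpret equivariant_bicombing G X act c by (rule bicombing)
  have "X \<noteq> {}" using X_covers[OF trivial_in_family] by blast
  moreover have "y \<in> orbit G act x"
    if x: "x \<in> X" and y: "y \<in> X" and sub: "stabilizer G act x \<subseteq> stabilizer G act y" for x y
  proof (rule ccontr)
    assume "y \<notin> orbit G act x"
    then have y': "y \<notin> orb x" by (simp add: orbit_act x)
    have out: "g <# z \<in> X - orb x" if z: "z \<in> X" "z \<notin> orb x" and g: "g \<in> carrier G" for z g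
    proof -
      have "z = inv g <# (g <# z)" using X_mult[OF z(1), of "inv g" g] X_one[OF z(1)] g by simp
      then have "g <# z \<notin> orb x"
        using z(2) obj_act[OF orb_obj[OF x], of "g <# z" "inv g"] g by auto
      then show ?thesis using X_act[OF z(1) g] by simp
    qed
    have "covering_gset G F (X - orb x)"
    proof
      show "\<exists>T\<in>obj. z \<in> T" if "z \<in> X - orb x" for z using X_obj that by blast
      show "g <# z \<in> X - orb x" if "z \<in> X - orb x" "g \<in> carrier G" for z g using out that by blast
      show "\<exists>z\<in>X - orb x. H \<subseteq> stab z" if H: "H \<in> F" for H
      proof -
        obtain z where z: "z \<in> X" "H \<subseteq> stab z" using X_covers[OF H] by blast
        show ?thesis
        proof (cases "z \<in> orb x")
          case True
          then obtain g where g: "g \<in> carrier G" "z = g <# x" by (auto simp: orb_def)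
          have "H \<subseteq> stab (g <# y)"
          proof
            fix h assume "h \<in> H"
            then have h: "h \<in> carrier G" "h <# (g <# x) = g <# x" using z(2) g(2) by (auto simp: stab_def)
            then have "inv g \<otimes> (h \<otimes> g) \<in> stab x"
              using g(1) x X_act by (simp add: stab_def X_mult) (simp add: X_mult[symmetric] X_one)
            then have "(inv g \<otimes> (h \<otimes> g)) <# y = y"
              using sub stabilizer_act x y by (auto simp: stab_def)
            then have "g <# ((inv g \<otimes> (h \<otimes> g)) <# y) = g <# y" by simp
            then have "h <# (g <# y) = g <# y"
              using g(1) h(1) y by (simp add: X_mult[symmetric] m_assoc[symmetric])
            then show "h \<in> stab (g <# y)" using h(1) by (simp add: stab_def)
          qed
          then show ?thesis using out[OF y y' g(1)] by blast
        next
          case False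
          then show ?thesis using z by blast
        qed
      qed
    qed
    from minimal[OF _ this] have "card X \<le> card (X - orb x)" by blast
    moreover have "card (X - orb x) < card X"
      by (rule psubset_card_mono[OF finite_X]) (use x self_orb[OF x] in blast)
    ultimately show False by simp
  qed
  ultimately obtain x where x: "x \<in> X" "stabilizer G act x = carrier G" using fixed_point by blast
  then show ?thesis using X_stab[OF x(1)] stabilizer_act by simp
qed

end

lemma (in finite_group_family) ex_minimal_covering:
  "\<exists>X. covering_gset G F X \<and> (\<forall>Y. covering_gset G F Y \<longrightarrow> card X \<le> card Y)"
proof -
  have "covering_gset G F (\<Union>obj)"
  proof
    show "\<exists>T\<in>obj. x \<in> T" if "x \<in> \<Union>obj" for x using that by blast
    show "g <# x \<in> \<Union>obj" if "x \<in> \<Union>obj" "g \<in> carrier G" for x g using obj_act that by blast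
    show "\<exists>x\<in>\<Union>obj. H \<subseteq> stab x" if "H \<in> F" for H
      using self_lcoset[OF that] lcosets_obj[OF that] subgroup_subset_stab_self[OF family_subgroup[OF that]]
      by blast
  qed
  then show ?thesis by (rule ex_has_least_nat)
qed

theorem theorem1p6:
  fixes G :: "('g, 'm) monoid_scheme" and F :: "'g set set"
  assumes "group G" and "finite (carrier G)"
    and "subgroup_family G F" and "\<forall>H\<in>F. H \<noteq> carrier G"
  shows "cohom_dim TYPE('u::infinite) G F \<ge> 2"
proof -
  interpret finite_group_family G F
    using assms by (simp add: finite_group_family_def finite_group_family_axioms_def)
  have "2 \<le> n" if res: "projective_resolution G F const_int_module P d \<epsilon>"
    and zero: "\<forall>i>n. zero_orbit_module G F (P i)"
    for n d \<epsilon> and P :: "nat \<Rightarrow> ('g, 'u) orbit_module"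
  proof (rule ccontr)
    assume "\<not> 2 \<le> n"
    then have P2: "zero_orbit_module G F (P 2)" using zero by simp
    have P: "projective_orbit_module G F (P i)" and d: "d i \<in> orbit_module_hom G F (P (Suc i)) (P i)" for i
      using res by (simp_all add: projective_resolution_def)
    have \<epsilon>: "\<epsilon> \<in> orbit_module_hom G F (P 0) const_int_module"
        "orbit_module_surj G F (P 0) const_int_module \<epsilon>"
        "orbit_module_exact G F (P 1) (P 0) const_int_module (d 0) \<epsilon>"
      and exact: "orbit_module_exact G F (P 2) (P 1) (P 0) (d 1) (d 0)"
      using res by (simp_all add: projective_resolution_def numeral_2_eq_2)
    have inj: "inj_on (d 0 S) (carrier (mobj (P 1) S))" if S: "S \<in> obj" for S
    proof -
      have cg: "comm_group (mobj (P i) S)" for i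
        using P[of i] S by (simp add: projective_orbit_module_def is_orbit_module_def)
      interpret h1: group_hom "mobj (P 2) S" "mobj (P 1) S" "d 1 S"
        using cg orbit_module_homD(1)[OF d[of 1] S]
        by (simp add: group_hom_def group_hom_axioms_def comm_group.axioms numeral_2_eq_2)
      interpret h0: group_hom "mobj (P 1) S" "mobj (P 0) S" "d 0 S"
        using cg orbit_module_homD(1)[OF d[of 0] S]
        by (simp add: group_hom_def group_hom_axioms_def comm_group.axioms)
      have "kernel (mobj (P 1) S) (mobj (P 0) S) (d 0 S) = d 1 S ` {\<one>\<^bsub>mobj (P 2) S\<^esub>}"
        using exact P2 S by (simp add: orbit_module_exact_def zero_orbit_module_def)
      also have "\<dots> = {\<one>\<^bsub>mobj (P 1) S\<^esub>}" by (simp only: image_insert image_empty h1.hom_one)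
      finally show ?thesis by (rule h0.trivial_ker_imp_inj)
    qed
    obtain X where X: "covering_gset G F X" and min: "\<And>Y. covering_gset G F Y \<Longrightarrow> card X \<le> card Y"
      using ex_minimal_covering by blast
    interpret X: covering_gset G F X by (rule X)
    have "d 0 \<in> orbit_module_hom G F (P 1) (P 0)" using d[of 0] by simp
    from X.ex_bicombing[OF P P this \<epsilon> inj]
    obtain c where "equivariant_bicombing G X X.act c" by blast
    from X.carrier_in_family[OF this] min have "carrier G \<in> F" by blast
    then show False using assms(4) by blast
  qed
  then show ?thesis
    unfolding cohom_dim_def proj_dim_def
    by (intro Inf_greatest) (auto simp: numeral_eq_enat)
qed

end
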